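(* Let $D\subseteq\mathbb{R}^2$ be the unit disk, and let $\theta>0$ be any exponent such that $|\mathcal{D}(D,x,R)|\lesssim R^\theta$ holds uniformly in $R$ and $x$. Let $p\ge 2$ and let $0<t<1$. Then, for any fixed $\varepsilon>0$, $$ \|\mathcal{D}(A,x,R,t)\|_{L^p} \lesssim \begin{cases} (Rt)^{\frac{1}{p}}R^{\frac{\theta(p-2)}{p}}, & \text{if } R^{1-2\theta} \geq t,\\ R^{\frac{1}{2}}t^{\frac{4-p}{2p}}, & \text{if } R^{1-2\theta} < t \text{ and } p < 4,\\ R^{\frac{\theta(p-4)+2+\varepsilon}{p}}, & \text{if } R^{1-2\theta} < t \text{ and } p \ge 4. \end{cases} $$
   Context: $\mathbb{T}^2=[0,1]\times[0,1]$; $\chi_E$ is the indicator function of $E$ and $|E|$ its area. For a bounded domain $\Omega\subseteq\mathbb{R}^2$, $R\Omega - x := \{y\in\mathbb{R}^2 : (y+x)/R\in\Omega\}$ and $$\mathcal{D}(\Omega,x,R) = \sum_{k\in\mathbb{Z}^2}\chi_{R\Omega-x}(k)-R^2|\Omega|,\qquad x\in\mathbb{T}^2,\ R\ge 1.$$ The annulus is $A(R,t)=\{y\in\mathbb{R}^2: R-t\le |y|\le R+t\}$, with $A(R,t)-x:=\{y\in\mathbb{R}^2: y+x\in A(R,t)\}$, and for $x\in\mathbb{T}^2$, $R\ge1$, $t\in(0,1)$, $$\mathcal{D}(A,x,R,t) = \sum_{k\in\mathbb{Z}^2}\chi_{A(R,t)-x}(k)-|A(R,t)|,\qquad \|\mathcal{D}(A,x,R,t)\|_{L^p}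 = \left(\int_{\mathbb{T}^2}|\mathcal{D}(A,x,R,t)|^pdx\right)^{1/p}.$$ The notation $h\lesssim g$ means $h\le C g$ for all sufficiently large $R$ with a constant $C>0$ independent of $R$, $t$ and $x$ (it may depend on the fixed parameters $p,\theta,\varepsilon$). *)

theory Defs
  imports "HOL-Analysis.Analysis"
begin

definition unit_square :: "(real^2) set" where
  "unit_square = {x. \<forall>i. 0 \<le> x $ i \<and> x $ i \<le> 1}"

definition int_lattice :: "(real^2) set" where
  "int_lattice = {k. \<forall>i. k $ i \<in> \<int>}"

definition dilate_shift :: "real \<Rightarrow> (real^2) set \<Rightarrow> real^2 \<Rightarrow> (real^2) set" where
  "dilate_shift R \<Omega> x = {y. (1 / R) *\<^sub>R (y + x) \<in> \<Omega>}"

definition discrepancy :: "(real^2) set \<Rightarrow> real^2 \<Rightarrow> real \<Rightarrow> real" where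
  "discrepancy \<Omega> x R =
     (\<Sum>\<^sub>\<infinity>k\<in>int_lattice. indicator (dilate_shift R \<Omega> x) k) - R\<^sup>2 * measure lebesgue \<Omega>"

text \<open>The unit disk is taken open, as it is used as a bounded domain.\<close>

definition unit_disk :: "(real^2) set" where
  "unit_disk = ball 0 1"

definition annulus :: "real \<Rightarrow> real \<Rightarrow> (real^2) set" where
  "annulus R t = {y. R - t \<le> norm y \<and> norm y \<le> R + t}"

definition annulus_shift :: "real \<Rightarrow> real \<Rightarrow> real^2 \<Rightarrow> (real^2) set" where
  "annulus_shift R t x = {y. y + x \<in> annulus R t}"

definition annulus_discrepancy :: "real^2 \<Rightarrow> real \<Rightarrow> real \<Rightarrow> real" where
  "annulus_discrepancy x R t =
     (\<Sum>\<^sub>\<infinity>k\<in>int_lattice. indicator (annulus_shift R t x) k) - measure lebesgue (annulus R t)"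

definition annulus_discrepancy_norm :: "real \<Rightarrow> real \<Rightarrow> real \<Rightarrow> real" where
  "annulus_discrepancy_norm p R t =
     (LINT x:unit_square|lebesgue. \<bar>annulus_discrepancy x R t\<bar> powr p) powr (1 / p)"

text \<open>
  For real exponents \<open>p > 0\<close> the integral above is not a default value: the integrand is bounded
  and measurable, as the following facts show.
\<close>

lemma finite_int_lattice_bounded: "finite {k \<in> int_lattice. norm k \<le> B}"
proof -
  let ?N = "{k :: real^2. \<forall>i. k $ i \<in> {j \<in> \<int>. \<bar>j\<bar> \<le> B}}"
  have "finite {j :: real. j \<in> \<int> \<and> \<bar>j\<bar> \<le> B}"
    by (rule finite_abs_int_segment)
  hence "finite ((\<lambda>(a, b). vector [a, b] :: real^2) `
      ({j. j \<in> \<int> \<and> \<bar>j\<bar> \<le> B} \<times> {j. j \<in> \<int> \<and> \<bar>j\<bar> \<le> B}))"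
    by blast
  moreover have "?N \<subseteq> (\<lambda>(a, b). vector [a, b]) `
      ({j. j \<in> \<int> \<and> \<bar>j\<bar> \<le> B} \<times> {j. j \<in> \<int> \<and> \<bar>j\<bar> \<le> B})"
  proof
    fix k :: "real^2" assume "k \<in> ?N"
    moreover have "k = vector [k $ 1, k $ 2]" by (simp add: vec_eq_iff forall_2)
    ultimately show "k \<in> (\<lambda>(a, b). vector [a, b]) `
        ({j. j \<in> \<int> \<and> \<bar>j\<bar> \<le> B} \<times> {j. j \<in> \<int> \<and> \<bar>j\<bar> \<le> B})"
      by (intro image_eqI[of _ _ "(k $ 1, k $ 2)"]) auto
  qed
  ultimately have "finite ?N" by (rule finite_subset[rotated])
  moreover have "{k \<in> int_lattice. norm k \<le> B} \<subseteq> ?N"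
    by (auto simp: int_lattice_def intro: order_trans[OF component_le_norm_cart])
  ultimately show ?thesis by (rule finite_subset[rotated])
qed

lemma annulus_discrepancy_eq:
  assumes "x \<in> unit_square"
  shows "annulus_discrepancy x R t =
    (\<Sum>k\<in>{k \<in> int_lattice. norm k \<le> R + t + 2}. indicator (annulus R t) (k + x))
      - measure lebesgue (annulus R t)"
proof -
  have "norm x \<le> (\<Sum>i\<in>UNIV. \<bar>x $ i\<bar>)" by (rule norm_le_l1_cart)
  also have "\<dots> \<le> 2"
  proof -
    have "\<bar>x $ i\<bar> \<le> 1" for i using assms by (auto simp: unit_square_def)
    from this[of 1] this[of 2] show ?thesis by (simp add: sum_2)
  qed
  finally have x: "norm x \<le> 2" .
  have "norm k \<le> R + t + 2" if "k + x \<in> annulus R t" for k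
  proof -
    have "norm k \<le> norm (k + x) + norm x" using norm_triangle_ineq4[of "k + x" x] by simp
    thus ?thesis using that x by (simp add: annulus_def)
  qed
  hence "(\<Sum>\<^sub>\<infinity>k\<in>int_lattice. indicator (annulus_shift R t x) k :: real) =
    (\<Sum>\<^sub>\<infinity>k\<in>{k \<in> int_lattice. norm k \<le> R + t + 2}. indicator (annulus R t) (k + x))"
    by (intro infsum_cong_neutral) (auto simp: annulus_shift_def indicator_def)
  thus ?thesis
    by (simp add: annulus_discrepancy_def infsum_finite finite_int_lattice_bounded)
qed

lemma annulus_discrepancy_norm_integrable:
  assumes "p > 0"
  shows "set_integrable lebesgue unit_square (\<lambda>x. \<bar>annulus_discrepancy x R t\<bar> powr p)"
proof -
  let ?K = "{k \<in> int_lattice. norm k \<le> R + t + 2}"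
  let ?f = "\<lambda>x. \<bar>(\<Sum>k\<in>?K. indicator (annulus R t) (k + x)) - measure lebesgue (annulus R t)\<bar> powr p"
  have sq: "unit_square = cbox 0 1"
    by (auto simp: unit_square_def mem_box_cart)
  have ann: "annulus R t \<in> sets borel"
  proof -
    have "annulus R t = {y. R - t \<le> norm y} \<inter> {y. norm y \<le> R + t}" by (auto simp: annulus_def)
    thus ?thesis by simp
  qed
  hence meas: "?f \<in> borel_measurable lborel"
    by measurable
  have bnd: "norm (?f x) \<le> (real (card ?K) + measure lebesgue (annulus R t)) powr p" for x
  proof -
    let ?S = "\<Sum>k\<in>?K. indicator (annulus R t) (k + x) :: real"
    have "?S \<le> real (card ?K)"
      using sum_bounded_above[of ?K "\<lambda>k. indicator (annulus R t) (k + x) :: real" 1]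
      by (simp add: indicator_def)
    moreover have "?S \<ge> 0" by (simp add: sum_nonneg)
    moreover have "measure lebesgue (annulus R t) \<ge> 0" by simp
    ultimately have "\<bar>?S - measure lebesgue (annulus R t)\<bar>
        \<le> real (card ?K) + measure lebesgue (annulus R t)" by linarith
    thus ?thesis using assms by (simp add: powr_mono2)
  qed
  have "set_integrable lebesgue unit_square ?f"
    unfolding set_integrable_def
  proof (rule integrableI_bounded_set_indicator)
    show "unit_square \<in> sets lebesgue" by (simp add: sq)
    show "?f \<in> borel_measurable lebesgue" using meas by (rule measurable_completion)
    have "emeasure lebesgue (cbox 0 1 :: (real^2) set) = emeasure lborel (cbox 0 1 :: (real^2) set)"
      by simp
    also have "\<dots> < \<infinity>" by (rule emeasure_lborel_cbox_finite)
    finally show "emeasure lebesgue unit_square < \<infinity>" unfolding sq .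
    show "AE x in lebesgue. x \<in> unit_square \<longrightarrow>
        norm (?f x) \<le> (real (card ?K) + measure lebesgue (annulus R t)) powr p"
      using bnd by simp
  qed
  moreover have "set_integrable lebesgue unit_square ?f \<longleftrightarrow> ?thesis"
    by (rule set_integrable_cong) (simp_all add: annulus_discrepancy_eq)
  ultimately show ?thesis by simp
qed

end

theory Submission
  imports Defs
begin

text \<open>
  The number of lattice points in a translated annulus is a periodic function of the translation
  \<open>x\<close>, and its Fourier coefficient at a lattice point \<open>m \<noteq> 0\<close> is the Fourier transform of the
  annulus at \<open>m\<close>. The whole theorem follows from the size of these coefficients,
  \<open>O(sqrt R * \<bar>m\<bar> powr (-1/2) * min t (1 / \<bar>m\<bar>))\<close>, together with the assumed bound on the disk.

  The transform of the disk of radius \<open>r\<close> at \<open>m\<close> is \<open>r * J\<^sub>1 (l * r) / l\<close> up to a constant factor, where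
  \<open>l = 2 * pi * \<bar>m\<bar>\<close>. The decay of \<open>J\<^sub>0\<close> and \<open>J\<^sub>1\<close> comes from an energy that decreases along the Bessel
  equation (\<open>bessel_energy_le\<close>). Bounding the transforms of the two disks separately gives the
  coefficient bound with \<open>1 / \<bar>m\<bar>\<close> in place of the minimum, and the mean value theorem with
  \<open>(\<mu> * J\<^sub>1 \<mu>)' = \<mu> * J\<^sub>0 \<mu>\<close> gives it with \<open>t\<close> (\<open>annulus_coeff_bound\<close>).

  For \<open>2 \<le> q < 4\<close> these coefficients force the \<open>L\<^sup>q\<close> norm of the discrepancy to be
  \<open>O(sqrt R * t powr ((4 - q) / (2 * q)))\<close> (\<open>annulus_moment_bound\<close>). The frequencies are cut into
  dyadic blocks. On the block \<open>\<bar>m\<bar> \<sim> 2 ^ j\<close>, which has about \<open>4 ^ j\<close> members, the supremum is bounded by the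
  sum of the coefficients and the \<open>L\<^sup>2\<close> norm by orthogonality; interpolating between the two, the \<open>L\<^sup>q\<close>
  norm is \<open>O(sqrt R * 2 powr (j * (3/2 - 2/q)) * min t (2 powr (- j)))\<close>. For \<open>q < 4\<close> the exponent
  \<open>3/2 - 2/q\<close> lies strictly between 0 and 1, so the sum over \<open>j\<close> is geometric in both
  directions away from \<open>2 ^ j \<sim> 1 / t\<close>, and no logarithm is lost. Questions of convergence are avoided by
  replacing the discrepancy by its convolutions with a positive trigonometric approximate identity.
  These are finite sums with coefficients of the same size, and they converge boundedly almost
  everywhere, because the count is locally constant off countably many circles.

  Finally, the annulus is a difference of two disks, so the discrepancy is \<open>O(R powr \<theta>)\<close> uniformly
  (\<open>annulus_discrepancy_sup_bound\<close>), and the \<open>p\<close>-th moment is at most \<open>(p - q)\<close> powers of this bound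
  times the \<open>q\<close>-th moment. The three cases are \<open>q = 2\<close>, \<open>q = p\<close>, and \<open>q = 4 - \<delta>\<close> with
  \<open>\<theta> * \<delta> \<le> \<epsilon>\<close>.
\<close>

section \<open>Integration over the plane in orthonormal coordinates\<close>

lemma measurable_vector2:
  "(\<lambda>(u, v). vector [u, v] :: real^2) \<in> borel_measurable (lborel \<Otimes>\<^sub>M lborel)"
proof -
  have "(\<lambda>(u, v). vector [u, v] :: real^2) = (\<lambda>z. fst z *\<^sub>R axis 1 1 + snd z *\<^sub>R axis 2 1)"
    by (auto simp: fun_eq_iff vec_eq_iff forall_2 axis_def)
  moreover have "\<dots> \<in> borel_measurable (borel \<Otimes>\<^sub>M borel)" by measurable
  ultimately show ?thesis by (simp cong: measurable_cong_sets)
qed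

lemma lborel_vec2_eq_distr:
  "(lborel :: (real^2) measure) = distr (lborel \<Otimes>\<^sub>M lborel) borel (\<lambda>(u, v). vector [u, v])"
proof (rule lborel_eqI)
  note measurable_vector2 [measurable]
  fix l u :: "real^2" assume le: "\<And>b. b \<in> Basis \<Longrightarrow> l \<bullet> b \<le> u \<bullet> b"
  have le': "l $ i \<le> u $ i" for i
    using le[of "axis i 1"] by (simp add: inner_axis)
  have "(\<lambda>(u, v). vector [u, v] :: real^2) -` box l u =
      {l$1<..<u$1} \<times> {l$2<..<u$2}"
    by (auto simp: mem_box_cart forall_2)
  hence "emeasure (distr (lborel \<Otimes>\<^sub>M lborel) borel (\<lambda>(u, v). vector [u, v])) (box l u)
       = emeasure (lborel \<Otimes>\<^sub>M lborel) ({l$1<..<u$1} \<times> {l$2<..<u$2})"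
    by (subst emeasure_distr) (auto simp: space_pair_measure)
  also have "\<dots> = ennreal ((u$1 - l$1) * (u$2 - l$2))"
    using le' by (subst lborel.emeasure_pair_measure_Times) (auto simp: ennreal_mult)
  also have "(u$1 - l$1) * (u$2 - l$2) = (\<Prod>b\<in>Basis. (u - l) \<bullet> b)"
    by (simp add: Basis_vec_def UNION_singleton_eq_range prod.reindex inj_on_def axis_eq_axis
        inner_axis UNIV_2 algebra_simps image_Un)
  finally show "emeasure (distr (lborel \<Otimes>\<^sub>M lborel) borel (\<lambda>(u, v). vector [u, v])) (box l u) =
      (\<Prod>b\<in>Basis. (u - l) \<bullet> b)" .
qed auto

lemma lborel_distr_orthogonal:
  fixes f :: "real^2 \<Rightarrow> real^2"
  assumes f: "orthogonal_transformation f"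
  shows "distr lborel borel f = lborel"
proof (rule lborel_eqI[symmetric])
  have lin: "linear f" using f by (rule orthogonal_transformation_linear)
  have [measurable]: "f \<in> borel_measurable borel"
    using lin by (intro borel_measurable_continuous_onI linear_continuous_on linear_conv_bounded_linear[THEN iffD1])
  have bij: "bij f" using f by (rule orthogonal_transformation_bij)
  have f': "orthogonal_transformation (inv f)" using f by (rule orthogonal_transformation_inv)
  fix l u :: "real^2" assume le: "\<And>b. b \<in> Basis \<Longrightarrow> l \<bullet> b \<le> u \<bullet> b"
  have vim: "f -` box l u = inv f ` box l u" using bij by (simp add: bij_vimage_eq_inv_image)
  have lm: "inv f ` box l u \<in> lmeasurable" and
       ms: "measure lebesgue (inv f ` box l u) = measure lebesgue (box l u)"
    using measure_orthogonal_image[OF f', of "box l u"] measurable_orthogonal_image[OF f', of "box l u"]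
    by blast+
  have bo: "inv f ` box l u \<in> sets borel"
    using measurable_sets[of f borel borel "box l u"] vim by simp
  have "emeasure (distr lborel borel f) (box l u) = emeasure lebesgue (inv f ` box l u)"
    using bo by (subst emeasure_distr) (auto simp: vim)
  also have "\<dots> = measure lebesgue (box l u)"
    using lm ms by (metis emeasure_eq_measure2)
  also have "\<dots> = (\<Prod>b\<in>Basis. (u - l) \<bullet> b)"
    using le by (simp add: measure_lborel_box_eq)
  finally show "emeasure (distr lborel borel f) (box l u) = (\<Prod>b\<in>Basis. (u - l) \<bullet> b)" .
qed auto

text \<open>
  Fubini in the coordinates of an arbitrary orthonormal basis. With the standard basis it integrates
  a cosine over a square; with a basis adapted to a frequency it reduces the Fourier transform of a
  disk to an integral over the lengths of parallel chords.
\<close>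

lemma integral_orthonormal_frame:
  fixes e e' :: "real^2" and g :: "real^2 \<Rightarrow> real"
  assumes e: "norm e = 1" "norm e' = 1" "e \<bullet> e' = 0" and g: "integrable lborel g"
  shows "(LINT z|lborel. g z) = (LINT u|lborel. LINT v|lborel. g (u *\<^sub>R e + v *\<^sub>R e'))"
proof -
  define f :: "real^2 \<Rightarrow> real^2" where "f z = (z $ 1) *\<^sub>R e + (z $ 2) *\<^sub>R e'" for z
  have lin: "linear f" by (rule linearI) (simp_all add: f_def algebra_simps)
  have of: "orthogonal_transformation f"
    unfolding orthogonal_transformation_def
  proof (intro conjI allI)
    fix v w
    have "e \<bullet> e = 1" "e' \<bullet> e' = 1" "e' \<bullet> e = 0"
      using e by (simp_all add: norm_eq_1 inner_commute)
    hence "f v \<bullet> f w = v $ 1 * w $ 1 + v $ 2 * w $ 2" using e(3)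
      by (simp add: f_def inner_add_left inner_add_right)
    thus "f v \<bullet> f w = v \<bullet> w" by (simp add: inner_vec_def sum_2)
  qed (rule lin)
  have [measurable]: "f \<in> borel_measurable borel"
    using lin by (intro borel_measurable_continuous_onI linear_continuous_on linear_conv_bounded_linear[THEN iffD1])
  have [measurable]: "g \<in> borel_measurable borel" using g by auto
  note T = measurable_vector2
  have gf: "integrable lborel (\<lambda>z. g (f z))"
    using g by (subst (asm) lborel_distr_orthogonal[OF of, symmetric]) (simp add: integrable_distr_eq)
  have gfT: "integrable (lborel \<Otimes>\<^sub>M lborel) (\<lambda>(u, v). g (u *\<^sub>R e + v *\<^sub>R e'))"
    using gf T by (subst (asm) lborel_vec2_eq_distr) (simp add: integrable_distr_eq f_def case_prod_unfold)
  have "(LINT z|lborel. g z) = (LINT z|lborel. g (f z))"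
    by (subst lborel_distr_orthogonal[OF of, symmetric]) (simp add: integral_distr)
  also have "\<dots> = (LINT z|(lborel \<Otimes>\<^sub>M lborel). g (f (case z of (u, v) \<Rightarrow> vector [u, v])))"
    using T by (subst lborel_vec2_eq_distr) (simp add: integral_distr)
  also have "\<dots> = (LINT z|(lborel \<Otimes>\<^sub>M lborel). (case z of (u, v) \<Rightarrow> g (u *\<^sub>R e + v *\<^sub>R e')))"
    by (simp add: f_def split_beta)
  also have "\<dots> = (LINT u|lborel. LINT v|lborel. g (u *\<^sub>R e + v *\<^sub>R e'))"
    using lborel_pair.integral_fst[OF gfT] by simp
  finally show ?thesis .
qed

lemma integrable_indicator_bounded:
  fixes f :: "'a::euclidean_space \<Rightarrow> real"
  assumes "S \<in> sets borel" "bounded S" "f \<in> borel_measurable borel" "\<And>z. z \<in> S \<Longrightarrow> \<bar>f z\<bar> \<le> B"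
  shows "integrable lborel (\<lambda>z. indicator S z * f z)"
proof -
  have "AE z in lborel. z \<in> S \<longrightarrow> norm (f z) \<le> B" using assms(4) by (intro AE_I2) simp
  from integrableI_bounded_set_indicator[OF _ _ emeasure_bounded_finite[OF assms(2)] this]
  show ?thesis using assms(1,3) by simp
qed

lemma AE_norm_neq: "AE z in (lborel :: (real^2) measure). norm (k + z) \<noteq> r"
proof -
  have "sphere (-k) r \<in> null_sets lebesgue"
    using negligible_sphere negligible_iff_null_sets by blast
  hence "sphere (-k) r \<in> null_sets lborel"
    by (subst (asm) null_sets_completion_iff) auto
  hence "AE z in lborel. z \<notin> sphere (-k) r" by (rule AE_not_in)
  moreover have "dist (-k) z = norm (k + z)" for z
  proof -
    have "- k - z = - (k + z)" by simp
    thus ?thesis by (simp only: dist_norm norm_minus_cancel)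
  qed
  ultimately show ?thesis by simp
qed

section \<open>Decay of Bessel functions\<close>

text \<open>
  These are \<open>pi\<close> times the classical Bessel functions \<open>J\<^sub>0\<close> and \<open>J\<^sub>1\<close>.
\<close>

definition bessel0 :: "real \<Rightarrow> real" where
  "bessel0 \<mu> = integral {-(pi/2)..pi/2} (\<lambda>\<phi>. cos (\<mu> * sin \<phi>))"

definition bessel1 :: "real \<Rightarrow> real" where
  "bessel1 \<mu> = integral {-(pi/2)..pi/2} (\<lambda>\<phi>. sin \<phi> * sin (\<mu> * sin \<phi>))"

lemma bessel0_deriv: "(bessel0 has_real_derivative - bessel1 \<mu>) (at \<mu>)"
proof -
  have "((\<lambda>\<mu>. integral (cbox (-(pi/2)) (pi/2)) (\<lambda>\<phi>. cos (\<mu> * sin \<phi>))) has_field_derivative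
      integral (cbox (-(pi/2)) (pi/2)) (\<lambda>\<phi>. - (sin \<phi> * sin (\<mu> * sin \<phi>)))) (at \<mu> within UNIV)"
    by (rule leibniz_rule_field_derivative)
       (auto intro!: derivative_eq_intros integrable_continuous_real continuous_intros
             simp: split_beta)
  thus ?thesis by (simp add: bessel0_def[abs_def] bessel1_def)
qed

text \<open>
  Integration by parts: \<open>\<mu>\<close> times the integrand on the left minus that of \<open>bessel1\<close> is the derivative
  of \<open>cos \<phi> * sin (\<mu> * sin \<phi>)\<close>, which vanishes at both end points.
\<close>

lemma integral_cos_squared_bessel:
  "\<mu> * integral {-(pi/2)..pi/2} (\<lambda>\<phi>. (cos \<phi>)\<^sup>2 * cos (\<mu> * sin \<phi>)) = bessel1 \<mu>"
proof -
  let ?I = "{-(pi/2)..pi/2}"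
  have "((\<lambda>\<phi>. \<mu> * ((cos \<phi>)\<^sup>2 * cos (\<mu> * sin \<phi>)) - sin \<phi> * sin (\<mu> * sin \<phi>)) has_integral
      (cos (pi/2) * sin (\<mu> * sin (pi/2)) - cos (-(pi/2)) * sin (\<mu> * sin (-(pi/2))))) ?I"
    by (rule fundamental_theorem_of_calculus)
       (auto intro!: derivative_eq_intros simp: power2_eq_square algebra_simps
             simp flip: has_real_derivative_iff_has_vector_derivative)
  hence "((\<lambda>\<phi>. \<mu> * ((cos \<phi>)\<^sup>2 * cos (\<mu> * sin \<phi>)) - sin \<phi> * sin (\<mu> * sin \<phi>)) has_integral 0) ?I"
    by simp
  hence "integral ?I (\<lambda>\<phi>. \<mu> * ((cos \<phi>)\<^sup>2 * cos (\<mu> * sin \<phi>)) - sin \<phi> * sin (\<mu> * sin \<phi>)) = 0"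
    by (rule integral_unique)
  moreover have "integral ?I (\<lambda>\<phi>. \<mu> * ((cos \<phi>)\<^sup>2 * cos (\<mu> * sin \<phi>)) - sin \<phi> * sin (\<mu> * sin \<phi>)) =
     integral ?I (\<lambda>\<phi>. \<mu> * ((cos \<phi>)\<^sup>2 * cos (\<mu> * sin \<phi>))) - integral ?I (\<lambda>\<phi>. sin \<phi> * sin (\<mu> * sin \<phi>))"
    by (rule integral_diff) (auto intro!: integrable_continuous_real continuous_intros)
  ultimately show ?thesis by (simp add: bessel1_def)
qed

lemma bessel1_deriv:
  assumes "\<mu> \<noteq> 0"
  shows "(bessel1 has_real_derivative bessel0 \<mu> - bessel1 \<mu> / \<mu>) (at \<mu>)"
proof -
  let ?I = "{-(pi/2)..pi/2}"
  have "((\<lambda>\<mu>. integral (cbox (-(pi/2)) (pi/2)) (\<lambda>\<phi>. sin \<phi> * sin (\<mu> * sin \<phi>))) has_field_derivative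
      integral (cbox (-(pi/2)) (pi/2)) (\<lambda>\<phi>. sin \<phi> * (sin \<phi> * cos (\<mu> * sin \<phi>)))) (at \<mu> within UNIV)"
    by (rule leibniz_rule_field_derivative)
       (auto intro!: derivative_eq_intros integrable_continuous_real continuous_intros
             simp: split_beta)
  moreover have "integral ?I (\<lambda>\<phi>. sin \<phi> * (sin \<phi> * cos (\<mu> * sin \<phi>))) =
      integral ?I (\<lambda>\<phi>. cos (\<mu> * sin \<phi>) - (cos \<phi>)\<^sup>2 * cos (\<mu> * sin \<phi>))"
    by (rule integral_cong)
       (simp add: sin_squared_eq left_diff_distrib flip: mult.assoc power2_eq_square)
  moreover have "\<dots> = bessel0 \<mu> - integral ?I (\<lambda>\<phi>. (cos \<phi>)\<^sup>2 * cos (\<mu> * sin \<phi>))"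
    unfolding bessel0_def
    by (rule integral_diff) (auto intro!: integrable_continuous_real continuous_intros)
  moreover have "integral ?I (\<lambda>\<phi>. (cos \<phi>)\<^sup>2 * cos (\<mu> * sin \<phi>)) = bessel1 \<mu> / \<mu>"
    using integral_cos_squared_bessel[of \<mu>] assms by (simp add: field_simps)
  ultimately show ?thesis by (simp add: bessel1_def[abs_def])
qed

text \<open>
  With \<open>y \<mu> = sqrt \<mu> * bessel0 \<mu>\<close> the Bessel equation reads \<open>y'' + (1 + 1 / (4 * \<mu>\<^sup>2)) * y = 0\<close>, and this is
  its energy \<open>y'\<^sup>2 + (1 + 1 / (4 * \<mu>\<^sup>2)) * y\<^sup>2\<close>.
\<close>

definition bessel_energy :: "real \<Rightarrow> real" where
  "bessel_energy \<mu> =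
     \<mu> * ((bessel0 \<mu>)\<^sup>2 + (bessel1 \<mu>)\<^sup>2) - bessel0 \<mu> * bessel1 \<mu> + (bessel0 \<mu>)\<^sup>2 / (2 * \<mu>)"

text \<open>
  The energy decreases because the potential \<open>1 + 1 / (4 * \<mu>\<^sup>2)\<close> does.
\<close>

lemma bessel_energy_le:
  assumes "1 \<le> \<mu>"
  shows "bessel_energy \<mu> \<le> bessel_energy 1"
proof (rule DERIV_nonpos_imp_nonincreasing[OF assms])
  fix x :: real assume x: "1 \<le> x"
  hence x0: "x \<noteq> 0" by simp
  have "(bessel_energy has_real_derivative - ((bessel0 x)\<^sup>2 / (2 * x\<^sup>2))) (at x)"
    unfolding bessel_energy_def[abs_def]
    using x by (auto intro!: derivative_eq_intros bessel0_deriv bessel1_deriv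
                     simp: field_simps power2_eq_square)
  thus "\<exists>y. (bessel_energy has_real_derivative y) (at x) \<and> y \<le> 0"
    by (rule exI[of _ "- ((bessel0 x)\<^sup>2 / (2 * x\<^sup>2))", OF conjI]) simp
qed

text \<open>
  For \<open>\<mu> \<ge> 1\<close> the energy is at least \<open>\<mu> / 2\<close> times the sum of the two squares, so the bounded energy
  yields the decay of both functions at once.
\<close>

lemma bessel_decay:
  obtains C where "C > 0" "\<And>\<mu>. 1 \<le> \<mu> \<Longrightarrow> \<bar>bessel0 \<mu>\<bar> \<le> C / sqrt \<mu>" 
    "\<And>\<mu>. 1 \<le> \<mu> \<Longrightarrow> \<bar>bessel1 \<mu>\<bar> \<le> C / sqrt \<mu>"
proof -
  \<comment> \<open>the maximum only ensures that the constant is positive\<close>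
  define M where "M = 2 * max 1 (bessel_energy 1)"
  have main: "(bessel0 \<mu>)\<^sup>2 \<le> M / \<mu> \<and> (bessel1 \<mu>)\<^sup>2 \<le> M / \<mu>" if \<mu>: "1 \<le> \<mu>" for \<mu>
  proof -
    define S P X where "S = (bessel0 \<mu>)\<^sup>2 + (bessel1 \<mu>)\<^sup>2" and "P = bessel0 \<mu> * bessel1 \<mu>"
      and "X = (bessel0 \<mu>)\<^sup>2 / (2 * \<mu>)"
    have "2 * P \<le> S"
      using sum_squares_bound[of "bessel0 \<mu>" "bessel1 \<mu>"] by (simp add: S_def P_def)
    moreover have "X \<ge> 0" using \<mu> by (simp add: X_def)
    moreover have "S \<le> \<mu> * S" using mult_right_mono[OF \<mu>, of S] by (simp add: S_def)
    moreover have "bessel_energy \<mu> = \<mu> * S - P + X"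
      by (simp add: bessel_energy_def S_def P_def X_def)
    ultimately have "\<mu> * S \<le> 2 * bessel_energy \<mu>" by linarith
    also have "\<dots> \<le> M" using bessel_energy_le[OF \<mu>] by (simp add: M_def)
    finally have "S \<le> M / \<mu>" using \<mu> by (simp add: field_simps)
    thus ?thesis unfolding S_def using zero_le_power2[of "bessel0 \<mu>"] zero_le_power2[of "bessel1 \<mu>"] by linarith
  qed
  show ?thesis
  proof
    show "sqrt M > 0" by (simp add: M_def)
    fix \<mu> :: real assume "1 \<le> \<mu>"
    with main[OF this] show "\<bar>bessel0 \<mu>\<bar> \<le> sqrt M / sqrt \<mu>" "\<bar>bessel1 \<mu>\<bar> \<le> sqrt M / sqrt \<mu>"
      by (auto simp flip: real_sqrt_divide real_sqrt_abs)
  qed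
qed

section \<open>Fourier coefficients of disks and annuli\<close>

text \<open>
  The chord of the disk at signed distance \<open>u\<close> from the centre, orthogonal to \<open>m\<close>, has length
  \<open>2 * sqrt (r\<^sup>2 - u\<^sup>2)\<close>, and the cosine is constant on it. Putting \<open>u = r * sin \<phi>\<close> turns the remaining
  integral into the one of \<open>integral_cos_squared_bessel\<close>.
\<close>

lemma disk_fourier_coefficient:
  fixes m :: "real^2"
  assumes r: "r > 0" and m: "m \<noteq> 0"
  shows "(LINT z|lborel. indicator (cball 0 r) z * cos (2*pi*(m \<bullet> z))) =
     2 * r * bessel1 (2*pi*norm m * r) / (2*pi*norm m)"
proof -
  define l where "l = 2*pi*norm m"
  have l: "l > 0" using m by (simp add: l_def)
  define e where "e = (1 / norm m) *\<^sub>R m"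
  define e' :: "real^2" where "e' = vector [- (e $ 2), e $ 1]"
  have e: "norm e = 1" using m by (simp add: e_def)
  have e': "norm e' = 1" "e \<bullet> e' = 0"
    using e by (simp_all add: e'_def norm_vec_def L2_set_def inner_vec_def sum_2 algebra_simps)
  have me: "m \<bullet> e = norm m" "m \<bullet> e' = 0"
  proof -
    have "m = norm m *\<^sub>R e" using m by (simp add: e_def)
    thus "m \<bullet> e = norm m" "m \<bullet> e' = 0"
      using e e' by (metis inner_scaleR_left norm_eq_1 mult.right_neutral, metis e'(2) inner_scaleR_left mult_zero_right)
  qed
  have nrm: "(norm (u *\<^sub>R e + v *\<^sub>R e'))\<^sup>2 = u\<^sup>2 + v\<^sup>2" for u v
    using e e' unfolding power2_norm_eq_inner
    by (simp add: norm_eq_1 inner_commute inner_add_left inner_add_right) (simp add: power2_eq_square)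
  define h where "h u = 2 * sqrt (r\<^sup>2 - u\<^sup>2) * cos (l * u)" for u
  have inner: "(LINT v|lborel. indicator (cball 0 r) (u *\<^sub>R e + v *\<^sub>R e') * cos (2*pi*(m \<bullet> (u *\<^sub>R e + v *\<^sub>R e')))) =
      indicator {-r..r} u *\<^sub>R h u" for u
  proof -
    have "norm (u *\<^sub>R e + v *\<^sub>R e') \<le> r \<longleftrightarrow> v\<^sup>2 \<le> r\<^sup>2 - u\<^sup>2" for v
      using r nrm[of u v] by (metis abs_le_square_iff abs_norm_cancel abs_of_pos le_diff_eq add.commute)
    hence ind: "indicator (cball 0 r) (u *\<^sub>R e + v *\<^sub>R e') = (indicator {v. v\<^sup>2 \<le> r\<^sup>2 - u\<^sup>2} v :: real)" for v
      by (simp add: indicator_def)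
    have "{v. v\<^sup>2 \<le> r\<^sup>2 - u\<^sup>2} = (if u \<in> {-r..r} then {- sqrt (r\<^sup>2 - u\<^sup>2)..sqrt (r\<^sup>2 - u\<^sup>2)} else {})"
    proof (cases "u \<in> {-r..r}")
      case True
      hence "u\<^sup>2 \<le> r\<^sup>2" using r by (intro abs_le_square_iff[THEN iffD1]) auto
      hence "v\<^sup>2 \<le> r\<^sup>2 - u\<^sup>2 \<longleftrightarrow> \<bar>v\<bar> \<le> sqrt (r\<^sup>2 - u\<^sup>2)" for v
        by (metis real_sqrt_abs real_sqrt_le_iff)
      hence "{v. v\<^sup>2 \<le> r\<^sup>2 - u\<^sup>2} = {v. \<bar>v\<bar> \<le> sqrt (r\<^sup>2 - u\<^sup>2)}" by (simp only:)
      also have "{v. \<bar>v\<bar> \<le> s} = {-s..s}" for s :: real by auto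
      finally show ?thesis using True by (simp only: if_True)
    next
      case False
      hence "\<not> u\<^sup>2 \<le> r\<^sup>2" using r by (subst abs_le_square_iff[symmetric]) auto
      hence "r\<^sup>2 - u\<^sup>2 < v\<^sup>2" for v using zero_le_power2[of v] by linarith
      thus ?thesis using False by (auto simp: not_le)
    qed
    moreover have "u \<in> {-r..r} \<Longrightarrow> r\<^sup>2 - u\<^sup>2 \<ge> 0"
      using r abs_le_square_iff[of u r] by auto
    ultimately show ?thesis
      by (auto simp: ind inner_add_right me h_def l_def mult_ac)
  qed
  have "(LINT z|lborel. indicator (cball 0 r) z * cos (2*pi*(m \<bullet> z))) =
     (LINT u|lborel. indicator {-r..r} u *\<^sub>R h u)"
    by (subst integral_orthonormal_frame[OF e e'])
       (auto simp: inner intro!: integrable_indicator_bounded[where B=1])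
  also have "\<dots> = integral {-r..r} h"
    using set_borel_integral_eq_integral(2)[of "{-r..r}" h]
      borel_integrable_compact[of "{-r..r}" h]
    by (simp add: set_integrable_def set_lebesgue_integral_def h_def[abs_def] continuous_intros)
  also have "\<dots> = integral {-(pi/2)..pi/2} (\<lambda>\<phi>. (r * cos \<phi>) *\<^sub>R h (r * sin \<phi>))"
  proof -
    have "r * sin x \<in> {-r..r}" for x
    proof -
      have "\<bar>r * sin x\<bar> \<le> r * 1"
        unfolding abs_mult using r by (intro mult_mono) auto
      thus ?thesis by auto
    qed
    hence "((\<lambda>\<phi>. (r * cos \<phi>) *\<^sub>R h (r * sin \<phi>)) has_integral
        integral {r * sin (-(pi/2))..r * sin (pi/2)} h) {-(pi/2)..pi/2}"
      using r
      by (intro has_integral_substitution[where c="-r" and d=r])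
         (auto simp: h_def[abs_def] intro!: continuous_intros derivative_eq_intros)
    thus ?thesis by (simp add: integral_unique)
  qed
  also have "\<dots> = integral {-(pi/2)..pi/2} (\<lambda>\<phi>. (2 * r\<^sup>2) * ((cos \<phi>)\<^sup>2 * cos (l * r * sin \<phi>)))"
  proof (rule integral_cong)
    fix \<phi> assume "\<phi> \<in> {-(pi/2)..pi/2}"
    hence c: "cos \<phi> \<ge> 0" by (intro cos_ge_zero) auto
    have "r\<^sup>2 - (r * sin \<phi>)\<^sup>2 = (r * cos \<phi>)\<^sup>2"
      by (simp add: cos_squared_eq power_mult_distrib algebra_simps)
    hence "sqrt (r\<^sup>2 - (r * sin \<phi>)\<^sup>2) = r * cos \<phi>" using c r by simp
    thus "(r * cos \<phi>) *\<^sub>R h (r * sin \<phi>) = (2 * r\<^sup>2) * ((cos \<phi>)\<^sup>2 * cos (l * r * sin \<phi>))"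
      by (simp add: h_def power2_eq_square mult_ac)
  qed
  also have "\<dots> = (2 * r\<^sup>2) * (bessel1 (l * r) / (l * r))"
    using integral_cos_squared_bessel[of "l * r"] l r by (simp add: field_simps)
  also have "\<dots> = 2 * r * bessel1 (l * r) / l"
    using r by (simp add: power2_eq_square)
  finally show ?thesis by (simp add: l_def)
qed

definition annulus_coeff :: "real \<Rightarrow> real \<Rightarrow> real^2 \<Rightarrow> real" where
  "annulus_coeff R t m = (LINT z|lborel. indicator (annulus R t) z * cos (2*pi*(m \<bullet> z)))"

lemma annulus_coeff_eq:
  assumes "0 < t" "t < R" "m \<noteq> 0"
  shows "annulus_coeff R t m =
     2 * (R + t) * bessel1 (2*pi*norm m * (R + t)) / (2*pi*norm m)
   - 2 * (R - t) * bessel1 (2*pi*norm m * (R - t)) / (2*pi*norm m)"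
proof -
  let ?I = "\<lambda>S. LINT z|lborel. indicator S z * cos (2*pi*(m \<bullet> z))"
  have "annulus R t = cball 0 (R + t) - ball 0 (R - t)"
    by (auto simp: annulus_def)
  moreover have "ball 0 (R - t) \<subseteq> (cball 0 (R + t) :: (real^2) set)" using assms by auto
  ultimately have "indicator (annulus R t) z =
      indicator (cball 0 (R + t)) z - (indicator (ball 0 (R - t)) z :: real)" for z
    by (auto simp: indicator_def)
  hence "annulus_coeff R t m = ?I (cball 0 (R + t)) - ?I (ball 0 (R - t))"
    unfolding annulus_coeff_def
    by (simp add: left_diff_distrib)
       (intro Bochner_Integration.integral_diff integrable_indicator_bounded[where B=1]; simp)
  also have "?I (ball 0 (R - t)) = ?I (cball 0 (R - t))"
  proof (rule integral_cong_AE)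
    have "(\<lambda>z. cos (2*pi*(m \<bullet> z))) \<in> borel_measurable borel"
      by (intro borel_measurable_continuous_onI continuous_intros)
    thus "(\<lambda>z. indicator (ball 0 (R - t)) z * cos (2*pi*(m \<bullet> z))) \<in> borel_measurable lborel"
      "(\<lambda>z. indicator (cball 0 (R - t)) z * cos (2*pi*(m \<bullet> z))) \<in> borel_measurable lborel"
      by (auto intro!: borel_measurable_times borel_measurable_indicator)
    show "AE z in lborel. indicator (ball 0 (R - t)) z * cos (2 * pi * (m \<bullet> z)) =
           indicator (cball 0 (R - t)) z * cos (2 * pi * (m \<bullet> z))"
      using AE_norm_neq[of 0 "R - t"] by eventually_elim (auto simp: indicator_def)
  qed
  finally show ?thesis using assms by (simp add: disk_fourier_coefficient)
qed

lemma norm_int_lattice_ge_1: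
  assumes "m \<in> int_lattice" "m \<noteq> 0"
  shows "norm m \<ge> 1"
proof -
  from assms(2) obtain i where i: "m $ i \<noteq> 0" by (auto simp: vec_eq_iff)
  have "m $ i \<in> \<int>" using assms(1) by (simp add: int_lattice_def)
  hence "1 \<le> \<bar>m $ i\<bar>" using i by (rule Ints_nonzero_abs_ge1)
  thus ?thesis using component_le_norm_cart[of m i] by linarith
qed

text \<open>
  Write \<open>l = 2 * pi * norm m\<close> and \<open>k \<mu> = \<mu> * bessel1 \<mu>\<close>. The coefficient is \<open>2 / l\<^sup>2\<close> times the difference of
  \<open>k\<close> at \<open>l * (R + t)\<close> and \<open>l * (R - t)\<close>. Since \<open>k\<close> and its derivative \<open>\<mu> * bessel0 \<mu>\<close> are both
  \<open>O(sqrt \<mu>)\<close>, that difference is at most \<open>O(sqrt (l * R))\<close>, and also at most \<open>l * t\<close> times this.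
\<close>

lemma annulus_coeff_bound:
  obtains C where "C > 0"
    "\<And>R t m. 2 \<le> R \<Longrightarrow> 0 < t \<Longrightarrow> t < 1 \<Longrightarrow> m \<in> int_lattice \<Longrightarrow> m \<noteq> 0 \<Longrightarrow>
       \<bar>annulus_coeff R t m\<bar> \<le> C * sqrt R / sqrt (norm m) * min t (1 / norm m)"
proof -
  obtain C where C: "C > 0" and J0: "\<And>\<mu>. 1 \<le> \<mu> \<Longrightarrow> \<bar>bessel0 \<mu>\<bar> \<le> C / sqrt \<mu>"
    and J1: "\<And>\<mu>. 1 \<le> \<mu> \<Longrightarrow> \<bar>bessel1 \<mu>\<bar> \<le> C / sqrt \<mu>"
    using bessel_decay by blast
  define k where "k \<mu> = \<mu> * bessel1 \<mu>" for \<mu>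
  have mult: "\<bar>\<mu> * y\<bar> \<le> C * sqrt \<mu>" if "1 \<le> \<mu>" "\<bar>y\<bar> \<le> C / sqrt \<mu>" for \<mu> y
  proof -
    have "\<bar>\<mu> * y\<bar> \<le> \<mu> * (C / sqrt \<mu>)" using that mult_left_mono[OF that(2), of \<mu>] by (simp add: abs_mult)
    also have "\<dots> = C * (\<mu> / sqrt \<mu>)" by simp
    also have "\<dots> = C * sqrt \<mu>" using that by (simp only: real_div_sqrt)
    finally show ?thesis .
  qed
  show ?thesis
  proof (rule that[of "8 * C"])
    show "8 * C > 0" using C by simp
    fix R t :: real and m :: "real^2"
    assume R: "2 \<le> R" and t: "0 < t" "t < 1" and m: "m \<in> int_lattice" "m \<noteq> 0"
    have n1: "norm m \<ge> 1" by (rule norm_int_lattice_ge_1[OF m])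
    define l where "l = 2 * pi * norm m"
    have pi: "2 * pi \<ge> 1" using pi_gt3 by linarith
    have lm: "l \<ge> norm m" unfolding l_def using mult_right_mono[OF pi, of "norm m"] by simp
    have l: "l \<ge> 1" using lm n1 by linarith
    have lx: "1 \<le> l * x" if "x \<ge> 1" for x using mult_mono[OF l that] l by simp
    have kb: "\<bar>k (l * x)\<bar> \<le> 2 * C * sqrt l * sqrt R" "\<bar>l * x * bessel0 (l * x)\<bar> \<le> 2 * C * sqrt l * sqrt R"
      if "1 \<le> x" "x \<le> R + 1" for x
    proof -
      have "x \<le> 4 * R" using that R by linarith
      hence "sqrt x \<le> sqrt (4 * R)" by simp
      also have "\<dots> = 2 * sqrt R" by (simp add: real_sqrt_mult)
      finally have "C * sqrt l * sqrt x \<le> C * sqrt l * (2 * sqrt R)"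
        by (rule mult_left_mono) (use C l in auto)
      hence *: "C * sqrt (l * x) \<le> 2 * C * sqrt l * sqrt R" by (simp add: real_sqrt_mult)
      show "\<bar>k (l * x)\<bar> \<le> 2 * C * sqrt l * sqrt R"
        unfolding k_def using mult[OF lx J1[OF lx]] that(1) * by fastforce
      show "\<bar>l * x * bessel0 (l * x)\<bar> \<le> 2 * C * sqrt l * sqrt R"
        using mult[OF lx J0[OF lx]] that(1) * by fastforce
    qed
    have eq: "annulus_coeff R t m = 2 / l\<^sup>2 * (k (l * (R + t)) - k (l * (R - t)))"
    proof -
      have "annulus_coeff R t m =
          2 * (R + t) * bessel1 (l * (R + t)) / l - 2 * (R - t) * bessel1 (l * (R - t)) / l"
        unfolding l_def by (rule annulus_coeff_eq) (use R t m in auto)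
      moreover have "2 * x * y / l = 2 / l\<^sup>2 * (l * x * y)" for x y
        using l by (simp add: power2_eq_square)
      ultimately show ?thesis by (simp only: k_def right_diff_distrib[of "2 / l\<^sup>2"])
    qed
    have "\<bar>k (l * (R + t)) - k (l * (R - t))\<bar> \<le> \<bar>k (l * (R + t))\<bar> + \<bar>k (l * (R - t))\<bar>"
      by (rule abs_triangle_ineq4)
    also have "\<dots> \<le> 2 * (2 * C * sqrt l * sqrt R)"
      using kb(1)[of "R + t"] kb(1)[of "R - t"] R t by linarith
    finally have b1: "\<bar>k (l * (R + t)) - k (l * (R - t))\<bar> \<le> 4 * C * sqrt l * sqrt R" by simp
    have "\<exists>z. z > R - t \<and> z < R + t \<and> k (l * (R + t)) - k (l * (R - t)) =
        (R + t - (R - t)) * (l * (l * z * bessel0 (l * z)))"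
    proof (rule MVT2)
      show "R - t < R + t" using t by simp
      fix x assume "R - t \<le> x" "x \<le> R + t"
      hence x: "x \<ge> 1" using R t by linarith
      have "l * x \<noteq> 0" using lx[OF x] by linarith
      have "(k has_real_derivative l * x * bessel0 (l * x)) (at (l * x))"
        unfolding k_def[abs_def] using \<open>l * x \<noteq> 0\<close>
        by (auto intro!: derivative_eq_intros bessel1_deriv simp: algebra_simps)
      hence "((\<lambda>x. k (l * x)) has_real_derivative l * x * bessel0 (l * x) * l) (at x)"
        by (rule DERIV_chain2) (auto intro!: derivative_eq_intros)
      thus "((\<lambda>x. k (l * x)) has_real_derivative l * (l * x * bessel0 (l * x))) (at x)"
        by (simp add: mult_ac)
    qed
    then obtain z where z: "R - t < z" "z < R + t"
      "k (l * (R + t)) - k (l * (R - t)) = 2 * t * l * (l * z * bessel0 (l * z))" by auto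
    have "\<bar>k (l * (R + t)) - k (l * (R - t))\<bar> = 2 * t * l * \<bar>l * z * bessel0 (l * z)\<bar>"
      unfolding z(3) using t l by (simp add: abs_mult)
    also have "\<dots> \<le> 2 * t * l * (2 * C * sqrt l * sqrt R)"
      by (rule mult_left_mono[OF kb(2)]) (use z R t l in auto)
    finally have b2: "\<bar>k (l * (R + t)) - k (l * (R - t))\<bar> \<le> 4 * C * sqrt l * sqrt R * (t * l)"
      by (simp add: mult_ac)
    have "\<bar>k (l * (R + t)) - k (l * (R - t))\<bar> \<le> 4 * C * sqrt l * sqrt R * min (t * l) 1"
      using b1 b2 by (auto simp: min_def)
    hence "\<bar>annulus_coeff R t m\<bar> \<le> 2 / l\<^sup>2 * (4 * C * sqrt l * sqrt R * min (t * l) 1)"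
      unfolding eq abs_mult by (intro mult_mono) auto
    also have "\<dots> = 8 * C * sqrt R * (sqrt l / l) * (min (t * l) 1 / l)"
      by (simp add: power2_eq_square)
    also have "sqrt l / l = 1 / sqrt l" using l by (simp add: sqrt_divide_self_eq inverse_eq_divide)
    also have "min (t * l) 1 / l = min t (1 / l)" using l by (simp add: min_divide_distrib_right)
    also have "8 * C * sqrt R * (1 / sqrt l) * min t (1 / l) \<le>
        8 * C * sqrt R * (1 / sqrt (norm m)) * min t (1 / norm m)"
    proof -
      have "1 / sqrt l \<le> 1 / sqrt (norm m)"
        by (intro frac_le) (use lm m in auto)
      moreover have "1 / l \<le> 1 / norm m" by (intro frac_le) (use lm m in auto)
      hence "min t (1 / l) \<le> min t (1 / norm m)" by linarith
      moreover have "min t (1 / l) \<ge> 0" using t l by simp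
      ultimately show ?thesis using C R l n1 by (intro mult_mono) auto
    qed
    finally show "\<bar>annulus_coeff R t m\<bar> \<le> 8 * C * sqrt R / sqrt (norm m) * min t (1 / norm m)"
      by simp
  qed
qed

section \<open>Cosine polynomials on the unit square\<close>

lemma integral_cos_full_period:
  fixes n :: int and c \<alpha> :: real
  assumes "n \<noteq> 0"
  shows "(LINT v|lborel. indicator {\<alpha>..\<alpha> + 1} v * cos (c + 2 * pi * of_int n * v)) = 0"
proof -
  define w where "w = 2 * pi * of_int n"
  have w: "w \<noteq> 0" using assms by (simp add: w_def)
  have "(LINT v|lborel. indicator {\<alpha>..\<alpha> + 1} v *\<^sub>R cos (c + w * v)) =
      sin (c + w * (\<alpha> + 1)) / w - sin (c + w * \<alpha>) / w"
    by (rule integral_FTC_Icc)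
       (use w in \<open>auto intro!: derivative_eq_intros continuous_intros
           simp flip: has_real_derivative_iff_has_vector_derivative\<close>)
  moreover have "sin (c + w * (\<alpha> + 1)) = sin (c + w * \<alpha>)"
  proof -
    have "c + w * (\<alpha> + 1) = (c + w * \<alpha>) + 2 * pi * of_int n" by (simp add: w_def algebra_simps)
    moreover have "sin (y + 2 * pi * of_int n) = sin y" for y
      by (simp add: sin_add sin_int_2pin cos_int_2pin)
    ultimately show ?thesis by (simp only:)
  qed
  ultimately show ?thesis by (simp add: w_def)
qed

definition square :: "real \<Rightarrow> (real^2) set" where
  "square \<alpha> = cbox (vec \<alpha>) (vec (\<alpha> + 1))"

lemma mem_square: "z \<in> square \<alpha> \<longleftrightarrow> z $ 1 \<in> {\<alpha>..\<alpha> + 1} \<and> z $ 2 \<in> {\<alpha>..\<alpha> + 1}"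
  by (simp add: square_def mem_box_cart forall_2 conj_ac)

lemma sets_square [measurable]: "square \<alpha> \<in> sets borel"
  by (simp add: square_def)

lemma unit_square_eq: "unit_square = square 0"
  by (rule set_eqI) (simp add: unit_square_def mem_square forall_2 conj_ac)

lemma integrable_square:
  fixes f :: "real^2 \<Rightarrow> real"
  assumes "continuous_on UNIV f"
  shows "integrable lborel (\<lambda>z. indicator (square \<alpha>) z * f z)"
proof -
  have "continuous_on (square \<alpha>) f" using assms by (rule continuous_on_subset) auto
  moreover have "compact (square \<alpha>)" by (simp add: square_def)
  ultimately show ?thesis using borel_integrable_compact by fastforce
qed

lemma integral_square_cos:
  assumes "m \<in> int_lattice" "m \<noteq> 0"
  shows "(LINT z|lborel. indicator (square \<alpha>) z * cos (2*pi*(m \<bullet> z))) = 0"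
proof -
  have key: "(LINT z|lborel. indicator (square \<alpha>) z * cos (2*pi*(m \<bullet> z))) = 0"
    if ij: "i \<noteq> j" "m $ j \<noteq> 0" for i j :: 2
  proof -
    obtain n where n: "m $ j = of_int n"
      using assms(1) by (auto simp: int_lattice_def elim!: Ints_cases[of "m $ j"])
    hence n0: "n \<noteq> 0" using ij by auto
    have *: "indicator (square \<alpha>) (u *\<^sub>R axis i 1 + v *\<^sub>R axis j 1) =
        (indicator {\<alpha>..\<alpha> + 1} u * indicator {\<alpha>..\<alpha> + 1} v :: real)" for u v
    proof -
      have "i = 1 \<and> j = 2 \<or> i = 2 \<and> j = 1" using ij(1) exhaust_2[of i] exhaust_2[of j] by metis
      thus ?thesis by (elim disjE conjE) (simp_all add: indicator_def mem_square axis_def conj_ac)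
    qed
    have **: "2*pi*(m \<bullet> (u *\<^sub>R axis i 1 + v *\<^sub>R axis j 1)) = 2*pi*(u * m $ i) + 2 * pi * of_int n * v" for u v
      by (simp add: inner_add_right inner_axis n algebra_simps)
    have "(LINT z|lborel. indicator (square \<alpha>) z * cos (2*pi*(m \<bullet> z))) =
       (LINT u|lborel. LINT v|lborel. indicator (square \<alpha>) (u *\<^sub>R axis i 1 + v *\<^sub>R axis j 1)
          * cos (2*pi*(m \<bullet> (u *\<^sub>R axis i 1 + v *\<^sub>R axis j 1))))"
      using ij(1)
      by (intro integral_orthonormal_frame integrable_square continuous_intros) (auto simp: inner_axis_axis)
    also have "\<dots> = (LINT u|lborel. LINT v|lborel. indicator {\<alpha>..\<alpha> + 1} u *
          (indicator {\<alpha>..\<alpha> + 1} v * cos (2*pi*(u * m $ i) + 2 * pi * of_int n * v)))"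
      by (simp only: * **) (simp only: mult.assoc)
    also have "\<dots> = 0" by (simp only: integral_mult_right_zero integral_cos_full_period[OF n0]) simp
    finally show ?thesis .
  qed
  from assms(2) have "m $ 1 \<noteq> 0 \<or> m $ 2 \<noteq> 0" by (simp add: vec_eq_iff forall_2)
  thus ?thesis using key[of 2 1] key[of 1 2] by auto
qed

lemma integral_indicator_square: "(LINT z|lborel. indicator (square \<alpha>) z) = (1 :: real)"
proof -
  have "cbox (vec \<alpha>) (vec (\<alpha> + 1)) \<noteq> ({} :: (real^2) set)"
    by (auto simp: interval_ne_empty_cart)
  from content_cbox_cart[OF this] have "measure lborel (square \<alpha>) = 1"
    by (simp add: square_def)
  thus ?thesis by simp
qed

text \<open>
  Cosines suffice because the annuli and the smoothing kernel are symmetric about the origin. The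
  frequencies \<open>m\<close> and \<open>- m\<close> may both occur in \<open>S\<close>, although they give the same function.
\<close>

definition cos_poly :: "(real^2) set \<Rightarrow> (real^2 \<Rightarrow> real) \<Rightarrow> real^2 \<Rightarrow> real" where
  "cos_poly S a z = (\<Sum>m\<in>S. a m * cos (2*pi*(m \<bullet> z)))"

lemma continuous_cos_poly [continuous_intros]: "continuous_on X (cos_poly S a)"
  unfolding cos_poly_def[abs_def] by (intro continuous_intros)

lemma measurable_cos_poly [measurable]: "cos_poly S a \<in> borel_measurable borel"
  by (intro borel_measurable_continuous_onI continuous_cos_poly)

lemma cos_poly_bound: "\<bar>cos_poly S a z\<bar> \<le> (\<Sum>m\<in>S. \<bar>a m\<bar>)"
  unfolding cos_poly_def
  by (rule order_trans[OF sum_abs]) (auto intro!: sum_mono simp: abs_mult mult_left_le)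

lemma int_lattice_add: "m \<in> int_lattice \<Longrightarrow> n \<in> int_lattice \<Longrightarrow> m + n \<in> int_lattice"
  and int_lattice_diff: "m \<in> int_lattice \<Longrightarrow> n \<in> int_lattice \<Longrightarrow> m - n \<in> int_lattice"
  and int_lattice_uminus: "m \<in> int_lattice \<Longrightarrow> - m \<in> int_lattice"
  and int_lattice_0: "0 \<in> int_lattice"
  and int_lattice_axis: "axis i 1 \<in> int_lattice"
  by (simp_all add: int_lattice_def axis_def)

lemma integral_square_cos_cos:
  assumes "m \<in> int_lattice" "n \<in> int_lattice"
  shows "(LINT z|lborel. indicator (square \<alpha>) z * (cos (2*pi*(m \<bullet> z)) * cos (2*pi*(n \<bullet> z)))) =
    (of_bool (n = m) + of_bool (n = - m)) / 2"
proof -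
  have one: "(LINT z|lborel. indicator (square \<alpha>) z * cos (2*pi*(k \<bullet> z))) = of_bool (k = 0)"
    if "k \<in> int_lattice" for k
    using integral_square_cos[OF that] integral_indicator_square by (cases "k = 0") auto
  have "(LINT z|lborel. indicator (square \<alpha>) z * (cos (2*pi*(m \<bullet> z)) * cos (2*pi*(n \<bullet> z)))) =
      (LINT z|lborel. (indicator (square \<alpha>) z * cos (2*pi*((m - n) \<bullet> z))
         + indicator (square \<alpha>) z * cos (2*pi*((m + n) \<bullet> z))) / 2)"
    by (intro Bochner_Integration.integral_cong)
       (auto simp: cos_times_cos inner_diff_left inner_add_left algebra_simps)
  also have "\<dots> = ((LINT z|lborel. indicator (square \<alpha>) z * cos (2*pi*((m - n) \<bullet> z)))
         + (LINT z|lborel. indicator (square \<alpha>) z * cos (2*pi*((m + n) \<bullet> z)))) / 2"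
    by (simp add: integrable_square continuous_intros)
  also have "\<dots> = (of_bool (n = m) + of_bool (n = - m)) / 2"
  proof -
    have "m - n = 0 \<longleftrightarrow> n = m" "m + n = 0 \<longleftrightarrow> n = - m"
      by (auto simp: add_eq_0_iff)
    thus ?thesis using assms
      by (simp only: one int_lattice_add int_lattice_diff add.commute[of "of_bool (n = m)"])
  qed
  finally show ?thesis .
qed

lemma integral_cos_poly_times_cos:
  assumes S: "finite S" "S \<subseteq> int_lattice" and n: "n \<in> int_lattice"
  shows "(LINT z|lborel. indicator (square \<alpha>) z * (cos_poly S a z * cos (2*pi*(n \<bullet> z)))) =
     (\<Sum>m\<in>S. a m * (of_bool (n = m) + of_bool (n = - m)) / 2)"
proof -
  have "(LINT z|lborel. indicator (square \<alpha>) z * (cos_poly S a z * cos (2*pi*(n \<bullet> z)))) =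
     (LINT z|lborel. (\<Sum>m\<in>S. a m * (indicator (square \<alpha>) z * (cos (2*pi*(m \<bullet> z)) * cos (2*pi*(n \<bullet> z))))))"
    by (intro Bochner_Integration.integral_cong)
       (auto simp: cos_poly_def sum_distrib_left sum_distrib_right mult_ac)
  also have "\<dots> = (\<Sum>m\<in>S. a m * (LINT z|lborel. indicator (square \<alpha>) z * (cos (2*pi*(m \<bullet> z)) * cos (2*pi*(n \<bullet> z)))))"
    by (simp add: integrable_square continuous_intros)
  also have "\<dots> = (\<Sum>m\<in>S. a m * (of_bool (n = m) + of_bool (n = - m)) / 2)"
    using S n by (intro sum.cong refl) (auto simp: integral_square_cos_cos subset_eq)
  finally show ?thesis .
qed

text \<open>
  Almost Parseval: since \<open>m\<close> and \<open>- m\<close> give the same cosine, the integral of the square involves the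
  products \<open>a m * a (- m)\<close> as well as \<open>(a m)\<^sup>2\<close>, each with weight 1/2 when \<open>m \<noteq> 0\<close>.
\<close>

lemma cos_poly_L2_bound:
  assumes S: "finite S" "S \<subseteq> int_lattice" and a: "\<And>m. m \<in> S \<Longrightarrow> \<bar>a m\<bar> \<le> \<beta>"
  shows "(LINT z|lborel. indicator (square \<alpha>) z * (cos_poly S a z)\<^sup>2) \<le> real (card S) * \<beta>\<^sup>2"
proof -
  have sq: "(cos_poly S a z)\<^sup>2 = (\<Sum>n\<in>S. a n * (cos_poly S a z * cos (2*pi*(n \<bullet> z))))" for z
    unfolding power2_eq_square by (subst (2) cos_poly_def) (simp add: sum_distrib_left mult_ac)
  have "(LINT z|lborel. indicator (square \<alpha>) z * (cos_poly S a z)\<^sup>2) =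
     (LINT z|lborel. (\<Sum>n\<in>S. a n * (indicator (square \<alpha>) z * (cos_poly S a z * cos (2*pi*(n \<bullet> z))))))"
    by (intro Bochner_Integration.integral_cong)
       (simp_all add: sq sum_distrib_left mult_ac)
  also have "\<dots> = (\<Sum>n\<in>S. a n * (LINT z|lborel. indicator (square \<alpha>) z * (cos_poly S a z * cos (2*pi*(n \<bullet> z)))))"
    by (simp add: integrable_square continuous_intros)
  also have "\<dots> \<le> (\<Sum>n\<in>S. \<beta>\<^sup>2)"
  proof (rule sum_mono)
    fix n assume n: "n \<in> S"
    hence b: "\<beta> \<ge> 0" using a[OF n] by linarith
    define d where "d m = (of_bool (n = m) + of_bool (n = - m) :: real) / 2" for m
    have "(\<Sum>m\<in>S. d m) = (\<Sum>m\<in>S. of_bool (m = n)) / 2 + (\<Sum>m\<in>S. of_bool (m = - n)) / 2"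
    proof -
      have "n = m \<longleftrightarrow> m = n" "n = - m \<longleftrightarrow> m = - n" for m by auto
      hence "d m = of_bool (m = n) / 2 + of_bool (m = - n) / 2" for m
        by (simp only: d_def add_divide_distrib)
      thus ?thesis by (simp only: sum.distrib sum_divide_distrib)
    qed
    also have "\<dots> \<le> 1" using S by (simp add: of_bool_def sum.delta)
    finally have d1: "(\<Sum>m\<in>S. d m) \<le> 1" .
    have "(LINT z|lborel. indicator (square \<alpha>) z * (cos_poly S a z * cos (2*pi*(n \<bullet> z)))) = (\<Sum>m\<in>S. a m * d m)"
      using S n by (subst integral_cos_poly_times_cos) (auto simp: d_def)
    hence "a n * (LINT z|lborel. indicator (square \<alpha>) z * (cos_poly S a z * cos (2*pi*(n \<bullet> z))))
        \<le> \<bar>a n\<bar> * \<bar>\<Sum>m\<in>S. a m * d m\<bar>"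
      by (metis abs_ge_self abs_mult)
    also have "\<dots> \<le> \<beta> * (\<Sum>m\<in>S. \<beta> * d m)"
      using a n b by (intro mult_mono order_trans[OF sum_abs] sum_mono)
        (auto simp: abs_mult d_def intro!: mult_right_mono)
    also have "\<dots> = \<beta>\<^sup>2 * (\<Sum>m\<in>S. d m)" by (simp add: sum_distrib_left power2_eq_square mult.assoc)
    also have "\<dots> \<le> \<beta>\<^sup>2" using d1 by (simp add: mult_left_le)
    finally show "a n * (LINT z|lborel. indicator (square \<alpha>) z * (cos_poly S a z * cos (2*pi*(n \<bullet> z)))) \<le> \<beta>\<^sup>2" .
  qed
  finally show ?thesis by simp
qed

section \<open>A trigonometric approximate identity\<close>

text \<open>
  Nonnegative coefficients are what makes the approximate identity harmless: if \<open>f \<ge> 0\<close> has such an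
  expansion, then testing against a single cosine bounds every coefficient by twice the mean of \<open>f\<close>.
\<close>

definition has_pos_cos_expansion :: "(real^2 \<Rightarrow> real) \<Rightarrow> bool" where
  "has_pos_cos_expansion f \<longleftrightarrow>
     (\<exists>S a. finite S \<and> S \<subseteq> int_lattice \<and> (\<forall>m. 0 \<le> a m) \<and> f = cos_poly S a)"

lemma pos_cos_const: "0 \<le> c \<Longrightarrow> has_pos_cos_expansion (\<lambda>_. c)"
  unfolding has_pos_cos_expansion_def
  by (rule exI[of _ "{0}"], rule exI[of _ "\<lambda>_. c"]) (auto simp: cos_poly_def[abs_def] int_lattice_0)

lemma pos_cos_scale:
  assumes "has_pos_cos_expansion f" "0 \<le> c" shows "has_pos_cos_expansion (\<lambda>z. c * f z)"
proof -
  from assms(1) obtain S a where *: "finite S" "S \<subseteq> int_lattice" "\<And>m. 0 \<le> a m" "f = cos_poly S a"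
    unfolding has_pos_cos_expansion_def by blast
  have "(\<lambda>z. c * f z) = cos_poly S (\<lambda>m. c * a m)"
    unfolding *(4) cos_poly_def[abs_def] by (simp add: sum_distrib_left mult.assoc)
  moreover have "0 \<le> c * a m" for m using *(3) assms(2) by simp
  ultimately show ?thesis using *(1,2) unfolding has_pos_cos_expansion_def
    by (intro exI[of _ S] exI[of _ "\<lambda>m. c * a m"]) simp
qed

lemma pos_cos_add:
  assumes "has_pos_cos_expansion f" "has_pos_cos_expansion g"
  shows "has_pos_cos_expansion (\<lambda>z. f z + g z)"
proof -
  from assms(1) obtain S a where f: "finite S" "S \<subseteq> int_lattice" "\<And>m. 0 \<le> a m" "f = cos_poly S a"
    unfolding has_pos_cos_expansion_def by blast
  from assms(2) obtain T b where g: "finite T" "T \<subseteq> int_lattice" "\<And>m. 0 \<le> b m" "g = cos_poly T b"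
    unfolding has_pos_cos_expansion_def by blast
  define c where "c m = (if m \<in> S then a m else 0) + (if m \<in> T then b m else 0)" for m
  have ext: "cos_poly U d z = (\<Sum>m\<in>S \<union> T. (if m \<in> U then d m else 0) * cos (2*pi*(m \<bullet> z)))"
    if "U \<subseteq> S \<union> T" for U d z
    unfolding cos_poly_def using f(1) g(1) that by (intro sum.mono_neutral_cong_left) auto
  have "f z + g z = cos_poly (S \<union> T) c z" for z
    unfolding f(4) g(4) ext[of S, OF Un_upper1] ext[of T, OF Un_upper2]
    by (simp add: cos_poly_def c_def sum.distrib distrib_right)
  moreover have "0 \<le> c m" for m using f(3) g(3) by (simp add: c_def)
  ultimately show ?thesis using f(1,2) g(1,2) unfolding has_pos_cos_expansion_def
    by (intro exI[of _ "S \<union> T"] exI[of _ c]) (simp add: fun_eq_iff)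
qed

text \<open>
  By the product formula, multiplication by \<open>cos (2*pi*(e \<bullet> z))\<close> averages the two shifts of the
  frequencies by \<open>e\<close> and by \<open>- e\<close>.
\<close>

lemma pos_cos_mult_cos:
  assumes "has_pos_cos_expansion f" "e \<in> int_lattice"
  shows "has_pos_cos_expansion (\<lambda>z. f z * cos (2*pi*(e \<bullet> z)))"
proof -
  from assms(1) obtain S a where f: "finite S" "S \<subseteq> int_lattice" "\<And>m. 0 \<le> a m" "f = cos_poly S a"
    unfolding has_pos_cos_expansion_def by blast
  have shift: "has_pos_cos_expansion (\<lambda>z. \<Sum>m\<in>S. a m * cos (2*pi*((m + d) \<bullet> z)))" if "d \<in> int_lattice" for d
  proof -
    have "(\<Sum>m\<in>S. a m * cos (2*pi*((m + d) \<bullet> z))) = cos_poly ((\<lambda>m. m + d) ` S) (\<lambda>m. a (m - d)) z" for z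
      unfolding cos_poly_def by (subst sum.reindex) (auto simp: inj_on_def)
    moreover have "(\<lambda>m. m + d) ` S \<subseteq> int_lattice" using f(2) that by (auto intro: int_lattice_add)
    ultimately show ?thesis using f(1,3) unfolding has_pos_cos_expansion_def
      by (intro exI[of _ "(\<lambda>m. m + d) ` S"] exI[of _ "\<lambda>m. a (m - d)"]) (simp add: fun_eq_iff)
  qed
  have prod: "a m * cos (2*pi*(m \<bullet> z)) * cos (2*pi*(e \<bullet> z)) =
      (1/2) * (a m * cos (2*pi*((m + e) \<bullet> z))) + (1/2) * (a m * cos (2*pi*((m + - e) \<bullet> z)))" for m z
    by (simp add: inner_add_left inner_diff_left distrib_left right_diff_distrib cos_add cos_diff
        mult.assoc)
  have "f z * cos (2*pi*(e \<bullet> z)) = (1/2) * (\<Sum>m\<in>S. a m * cos (2*pi*((m + e) \<bullet> z)))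
      + (1/2) * (\<Sum>m\<in>S. a m * cos (2*pi*((m + - e) \<bullet> z)))" for z
    unfolding f(4) cos_poly_def sum_distrib_right prod by (simp only: sum.distrib sum_distrib_left)
  moreover have "has_pos_cos_expansion (\<lambda>z. (1/2) * (\<Sum>m\<in>S. a m * cos (2*pi*((m + e) \<bullet> z)))
      + (1/2) * (\<Sum>m\<in>S. a m * cos (2*pi*((m + - e) \<bullet> z))))"
    by (intro pos_cos_add pos_cos_scale shift assms int_lattice_uminus) auto
  ultimately show ?thesis by (simp only:)
qed

text \<open>
  On the unit square around the origin this function attains its maximum 1 only at the origin, so its
  normalised powers concentrate there.
\<close>

definition bump :: "real^2 \<Rightarrow> real" where
  "bump z = (2 + cos (2*pi*(z $ 1)) + cos (2*pi*(z $ 2))) / 4"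

definition bump_mass :: "nat \<Rightarrow> real" where
  "bump_mass N = (LINT z|lborel. indicator (square (-1/2)) z * bump z ^ N)"

lemma bump_nonneg: "0 \<le> bump z"
proof -
  have "0 \<le> (2 + x + y) / 4" if "- 1 \<le> x" "- 1 \<le> y" for x y :: real using that by simp
  thus ?thesis unfolding bump_def by (metis cos_ge_minus_one)
qed

lemma bump_le_1: "bump z \<le> 1"
proof -
  have "(2 + x + y) / 4 \<le> 1" if "x \<le> 1" "y \<le> 1" for x y :: real using that by simp
  thus ?thesis unfolding bump_def by (metis cos_le_one)
qed

lemma continuous_bump [continuous_intros]: "continuous_on X bump"
  unfolding bump_def[abs_def] by (intro continuous_intros) auto

lemma measurable_bump [measurable]: "bump \<in> borel_measurable borel"
  by (intro borel_measurable_continuous_onI continuous_bump)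

lemma bump_power_expansion: "has_pos_cos_expansion (\<lambda>z. bump z ^ N)"
proof (induction N)
  case 0
  show ?case using pos_cos_const[of 1] by simp
next
  case (Suc N)
  have "bump z ^ Suc N = (1/2) * bump z ^ N + (1/4) * (bump z ^ N * cos (2*pi*(axis 1 1 \<bullet> z)))
     + (1/4) * (bump z ^ N * cos (2*pi*(axis 2 1 \<bullet> z)))" for z
    by (subst power_Suc, subst (1) bump_def) (simp add: inner_axis' field_simps)
  moreover have "has_pos_cos_expansion (\<lambda>z. (1/2) * bump z ^ N + (1/4) * (bump z ^ N * cos (2*pi*(axis 1 1 \<bullet> z)))
     + (1/4) * (bump z ^ N * cos (2*pi*(axis 2 1 \<bullet> z))))"
    by (intro pos_cos_add pos_cos_scale pos_cos_mult_cos Suc int_lattice_axis) auto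
  ultimately show ?case by (simp only:)
qed

lemma bump_less_1:
  assumes "z \<in> square (-1/2)" "z \<noteq> 0"
  shows "bump z < 1"
proof (rule ccontr)
  assume "\<not> bump z < 1"
  hence c: "cos (2*pi*(z $ 1)) = 1" "cos (2*pi*(z $ 2)) = 1"
  proof -
    have "x = 1 \<and> y = 1" if "x \<le> 1" "y \<le> 1" "\<not> (2 + x + y) / 4 < 1" for x y :: real
      using that by simp
    from this[OF cos_le_one cos_le_one \<open>\<not> bump z < 1\<close>[unfolded bump_def]]
    show "cos (2*pi*(z $ 1)) = 1" "cos (2*pi*(z $ 2)) = 1" by blast+
  qed
  have 0: "x = 0" if "cos (2*pi*x) = 1" "-1/2 \<le> x" "x \<le> 1/2" for x :: real
  proof -
    from that(1) obtain n :: int where "2*pi*x = of_int n * 2 * pi" by (auto simp: cos_one_2pi_int)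
    hence x: "x = of_int n" by simp
    hence "n = 0" using that(2,3) by linarith
    thus ?thesis using x by simp
  qed
  have "z $ 1 = 0" "z $ 2 = 0" using 0[OF c(1)] 0[OF c(2)] assms(1) by (simp_all add: mem_square)
  thus False using assms(2) by (simp add: vec_eq_iff forall_2)
qed

text \<open>
  Near the origin the bump exceeds \<open>\<sigma>\<close>, and \<open>B\<close> is the area of a ball on which it does.
\<close>

lemma bump_mass_lower:
  assumes "0 < \<sigma>" "\<sigma> < 1"
  obtains B where "B > 0" "\<And>N. B * \<sigma> ^ N \<le> bump_mass N"
proof -
  have "isCont bump 0" using continuous_bump[of UNIV] by (simp add: continuous_on_eq_continuous_at)
  moreover have b0: "bump 0 = 1" by (simp add: bump_def)
  ultimately have "\<forall>\<^sub>F z in at 0. bump z > \<sigma>"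
    using assms by (intro order_tendstoD(1)[of bump 1]) (auto simp: isCont_def)
  then obtain d where d: "d > 0" "\<And>z. z \<noteq> 0 \<Longrightarrow> norm z < d \<Longrightarrow> bump z > \<sigma>"
    unfolding eventually_at by auto
  define r where "r = min d (1/2)"
  have r: "r > 0" using d by (simp add: r_def)
  have big: "\<sigma> \<le> bump z" if "z \<in> ball 0 r" for z
    using that d(2)[of z] assms b0 by (cases "z = 0") (auto simp: r_def)
  have sub: "ball 0 r \<subseteq> square (-1/2)"
  proof
    fix z :: "real^2" assume "z \<in> ball 0 r"
    hence "norm z \<le> 1/2" by (simp add: r_def)
    hence "\<bar>z $ i\<bar> \<le> 1/2" for i using component_le_norm_cart[of z i] by linarith
    from this[of 1] this[of 2] show "z \<in> square (-1/2)"
      unfolding mem_square atLeastAtMost_iff by (intro conjI; linarith)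
  qed
  show ?thesis
  proof (rule that[of "measure lborel (ball (0 :: real^2) r)"])
    show "measure lborel (ball (0 :: real^2) r) > 0" using r by simp
    fix N
    have "measure lborel (ball (0 :: real^2) r) * \<sigma> ^ N = (LINT z|lborel. indicator (ball (0 :: real^2) r) z * \<sigma> ^ N)"
      by simp
    also have "\<dots> \<le> bump_mass N"
      unfolding bump_mass_def
    proof (rule integral_mono)
      show "integrable lborel (\<lambda>z. indicator (ball (0 :: real^2) r) z * \<sigma> ^ N)"
        by (rule integrable_indicator_bounded) auto
      show "integrable lborel (\<lambda>z. indicator (square (-1/2)) z * bump z ^ N)"
        by (intro integrable_square continuous_intros)
      fix z :: "real^2"
      show "indicator (ball 0 r) z * \<sigma> ^ N \<le> indicator (square (-1/2)) z * bump z ^ N"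
      proof (cases "z \<in> ball 0 r")
        case True
        thus ?thesis using power_mono[OF big[OF True], of N] assms sub by (auto simp: indicator_def)
      qed (use bump_nonneg[of z] in simp)
    qed
    finally show "measure lborel (ball (0 :: real^2) r) * \<sigma> ^ N \<le> bump_mass N" .
  qed
qed

lemma bump_mass_pos: "bump_mass N > 0"
proof -
  obtain B where "B > 0" "\<And>N. B * (1/2) ^ N \<le> bump_mass N"
    using bump_mass_lower[of "1/2"] by auto
  moreover have "B * (1/2) ^ N > 0" using \<open>B > 0\<close> by simp
  ultimately show ?thesis by (meson less_le_trans)
qed

text \<open>
  After division by its mean, the power of the bump has constant term 1, and its other coefficients
  lie between 0 and 2. Hence convolution with it changes a Fourier coefficient by a bounded factor
  and preserves the mean.
\<close>

lemma bump_power_coefficients: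
  obtains S b where "finite S" "S \<subseteq> int_lattice" "0 \<in> S" "b 0 = 1"
    "\<And>m. m \<in> S \<Longrightarrow> 0 \<le> b m \<and> b m \<le> 2" "\<And>z. bump z ^ N = bump_mass N * cos_poly S b z"
proof -
  obtain S a where S: "finite S" "S \<subseteq> int_lattice" and a: "\<And>m. 0 \<le> a m"
    and eq: "\<And>z. bump z ^ N = cos_poly S a z"
    using bump_power_expansion[of N] unfolding has_pos_cos_expansion_def by (metis (no_types))
  have int: "(LINT z|lborel. indicator (square (-1/2)) z * (bump z ^ N * cos (2*pi*(n \<bullet> z)))) =
     (\<Sum>m\<in>S. a m * (of_bool (n = m) + of_bool (n = - m)) / 2)" if "n \<in> int_lattice" for n
    unfolding eq by (rule integral_cos_poly_times_cos[OF S that])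
  have "bump_mass N = (\<Sum>m\<in>S. a m * (of_bool (0 = m) + of_bool (0 = - m)) / 2)"
    using int[OF int_lattice_0] by (simp add: bump_mass_def)
  also have "\<dots> = (\<Sum>m\<in>S. if m = 0 then a m else 0)" by (intro sum.cong) auto
  also have "\<dots> = (if 0 \<in> S then a 0 else 0)" using S by simp
  finally have m0: "bump_mass N = (if 0 \<in> S then a 0 else 0)" .
  have pos: "bump_mass N > 0" by (rule bump_mass_pos)
  have le: "a m \<le> 2 * bump_mass N" if m: "m \<in> S" for m
  proof -
    have "a m / 2 \<le> a m * (of_bool (m = m) + of_bool (m = - m)) / 2" using a[of m] by simp
    also have "\<dots> \<le> (\<Sum>n\<in>S. a n * (of_bool (m = n) + of_bool (m = - n)) / 2)"
      by (rule member_le_sum[OF m]) (use a S in auto)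
    also have "\<dots> = (LINT z|lborel. indicator (square (-1/2)) z * (bump z ^ N * cos (2*pi*(m \<bullet> z))))"
      using int m S(2) by (simp add: subset_eq)
    also have "\<dots> \<le> bump_mass N"
      unfolding bump_mass_def
      by (intro integral_mono integrable_square continuous_intros)
         (auto simp: indicator_def bump_nonneg mult_left_le)
    finally show ?thesis by simp
  qed
  show ?thesis
  proof (rule that[of S "\<lambda>m. a m / bump_mass N"])
    show "0 \<in> S" "a 0 / bump_mass N = 1" using m0 pos by (auto split: if_splits)
    show "0 \<le> a m / bump_mass N \<and> a m / bump_mass N \<le> 2" if "m \<in> S" for m
      using a[of m] le[OF that] pos by (simp add: divide_le_eq)
    show "bump z ^ N = bump_mass N * cos_poly S (\<lambda>m. a m / bump_mass N) z" for z
      using pos unfolding eq cos_poly_def by (simp add: sum_distrib_left)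
  qed fact+
qed

text \<open>
  Away from the origin the bump is at most some \<open>\<rho> < 1\<close>, while its mass decays no faster than
  \<open>\<sigma> ^ N\<close> for any chosen \<open>\<sigma>\<close> between \<open>\<rho>\<close> and 1.
\<close>

lemma bump_concentrates:
  assumes \<delta>: "\<delta> > 0"
  shows "(\<lambda>N. (LINT z|lborel. indicator (square (-1/2) - ball 0 \<delta>) z * bump z ^ N) / bump_mass N) \<longlonglongrightarrow> 0"
proof -
  let ?K = "square (-1/2) - ball 0 \<delta>"
  have "compact ?K" by (intro compact_diff) (auto simp: square_def)
  obtain \<rho> where \<rho>: "0 \<le> \<rho>" "\<rho> < 1" "\<And>z. z \<in> ?K \<Longrightarrow> bump z \<le> \<rho>"
  proof (cases "?K = {}")
    case True
    show ?thesis by (rule that[of 0]) (simp, simp, use True in blast)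
  next
    case False
    then obtain z where z: "z \<in> ?K" "\<And>y. y \<in> ?K \<Longrightarrow> bump y \<le> bump z"
      using continuous_attains_sup[OF \<open>compact ?K\<close> False continuous_bump] by blast
    have "z \<noteq> 0" using z(1) \<delta> by auto
    hence "bump z < 1" using bump_less_1 z(1) by auto
    thus ?thesis using that[of "bump z"] z bump_nonneg by auto
  qed
  define \<sigma> where "\<sigma> = (1 + \<rho>) / 2"
  have \<sigma>: "0 < \<sigma>" "\<sigma> < 1" "\<rho> < \<sigma>" using \<rho> by (simp_all add: \<sigma>_def)
  obtain B where B: "B > 0" "\<And>N. B * \<sigma> ^ N \<le> bump_mass N"
    using bump_mass_lower[OF \<sigma>(1,2)] by blast
  have intK: "integrable lborel (\<lambda>z. indicator ?K z * bump z ^ N)" for N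
    by (rule integrable_indicator_bounded[where B=1])
       (auto simp: square_def bounded_diff power_le_one bump_nonneg bump_le_1)
  have upper: "(LINT z|lborel. indicator ?K z * bump z ^ N) \<le> \<rho> ^ N" for N
  proof -
    have "(LINT z|lborel. indicator ?K z * bump z ^ N) \<le> (LINT z|lborel. indicator (square (-1/2)) z * \<rho> ^ N)"
    proof (rule integral_mono[OF intK integrable_square])
      fix z :: "real^2"
      show "indicator ?K z * bump z ^ N \<le> indicator (square (-1/2)) z * \<rho> ^ N"
      proof (cases "z \<in> ?K")
        case True
        thus ?thesis using power_mono[OF \<rho>(3)[OF True] bump_nonneg, of N] by simp
      qed (use \<rho>(1) in simp)
    qed (intro continuous_intros)
    also have "\<dots> = \<rho> ^ N" using integral_indicator_square[of "-1/2"] by simp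
    finally show ?thesis .
  qed
  have "(\<lambda>N. (\<rho> / \<sigma>) ^ N * (1 / B)) \<longlonglongrightarrow> 0 * (1 / B)"
    using \<sigma> \<rho> by (intro tendsto_mult LIMSEQ_realpow_zero tendsto_const) auto
  hence lim: "(\<lambda>N. (\<rho> / \<sigma>) ^ N * (1 / B)) \<longlonglongrightarrow> 0" by simp
  show ?thesis
  proof (rule real_tendsto_sandwich[OF _ _ tendsto_const lim])
    show "\<forall>\<^sub>F N in sequentially. 0 \<le> (LINT z|lborel. indicator ?K z * bump z ^ N) / bump_mass N"
      by (intro always_eventually allI divide_nonneg_pos bump_mass_pos integral_nonneg_AE AE_I2)
         (simp add: bump_nonneg)
    have "(LINT z|lborel. indicator ?K z * bump z ^ N) / bump_mass N \<le> \<rho> ^ N / (B * \<sigma> ^ N)" for N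
      using upper[of N] B \<sigma> \<rho> by (intro frac_le) auto
    thus "\<forall>\<^sub>F N in sequentially. (LINT z|lborel. indicator ?K z * bump z ^ N) / bump_mass N
        \<le> (\<rho> / \<sigma>) ^ N * (1 / B)"
      by (simp add: power_divide mult.commute)
  qed
qed

section \<open>Smoothing the lattice point count\<close>

text \<open>
  The half-open square, so that its lattice translates partition the plane exactly.
\<close>

definition tile :: "(real^2) set" where
  "tile = {z. \<forall>i. - 1/2 \<le> z $ i \<and> z $ i < 1/2}"

definition nearest_lattice_point :: "real^2 \<Rightarrow> real^2" where
  "nearest_lattice_point z = (\<chi> i. of_int \<lfloor>z $ i + 1/2\<rfloor>)"

lemma sets_tile [measurable]: "tile \<in> sets borel"
proof -
  have eq: "tile = (\<Inter>i. {z. - 1/2 \<le> z $ i} \<inter> {z. z $ i < 1/2})" by (auto simp: tile_def)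
  have "{z :: real^2. - 1/2 \<le> z $ i} \<inter> {z. z $ i < 1/2} \<in> sets borel" for i
    by (intro sets.Int borel_closed borel_open closed_Collect_le open_Collect_less continuous_intros)
  thus ?thesis unfolding eq by (intro sets.finite_INT) auto
qed

lemma tile_subset_square: "tile \<subseteq> square (-1/2)"
  by (auto simp: tile_def mem_square less_imp_le)

lemma nearest_lattice_point_in: "nearest_lattice_point z \<in> int_lattice"
  by (simp add: nearest_lattice_point_def int_lattice_def)

lemma diff_in_tile_iff:
  assumes "k \<in> int_lattice"
  shows "z - k \<in> tile \<longleftrightarrow> k = nearest_lattice_point z"
proof -
  have "- 1/2 \<le> z $ i - k $ i \<and> z $ i - k $ i < 1/2 \<longleftrightarrow> k $ i = of_int \<lfloor>z $ i + 1/2\<rfloor>" for i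
  proof -
    obtain n where n: "k $ i = of_int n" using assms by (auto simp: int_lattice_def elim: Ints_cases)
    have "\<lfloor>z $ i + 1/2\<rfloor> = n \<longleftrightarrow> of_int n \<le> z $ i + 1/2 \<and> z $ i + 1/2 < of_int n + 1"
      by (rule floor_eq_iff)
    thus ?thesis unfolding n of_int_eq_iff by (auto simp: algebra_simps)
  qed
  thus ?thesis by (simp add: tile_def nearest_lattice_point_def vec_eq_iff)
qed

lemma norm_nearest_lattice_point: "norm (nearest_lattice_point z) \<le> norm z + 1"
proof -
  let ?k = "nearest_lattice_point z"
  have "z - ?k \<in> tile" using diff_in_tile_iff[OF nearest_lattice_point_in] by blast
  hence "- 1/2 \<le> (z - ?k) $ i \<and> (z - ?k) $ i < 1/2" for i
    unfolding tile_def mem_Collect_eq by (rule spec)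
  moreover have "- 1/2 \<le> y \<and> y < 1/2 \<Longrightarrow> \<bar>y\<bar> \<le> 1/2" for y :: real by auto
  ultimately have "\<bar>(z - ?k) $ i\<bar> \<le> 1/2" for i by blast
  hence "(\<Sum>i\<in>UNIV. \<bar>(z - ?k) $ i\<bar>) \<le> (\<Sum>i\<in>(UNIV :: 2 set). 1/2)" by (intro sum_mono)
  hence "norm (z - ?k) \<le> 1" using norm_le_l1_cart[of "z - ?k"] by simp
  thus ?thesis using norm_triangle_ineq4[of z "z - ?k"] by simp
qed

lemma integral_tile_eq_square:
  fixes f :: "real^2 \<Rightarrow> real"
  assumes [measurable]: "f \<in> borel_measurable borel"
  shows "(LINT z|lborel. indicator tile z * f z) = (LINT z|lborel. indicator (square (-1/2)) z * f z)"
proof (rule integral_cong_AE)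
  show "(\<lambda>z. indicator tile z * f z) \<in> borel_measurable lborel"
    "(\<lambda>z. indicator (square (-1/2)) z * f z) \<in> borel_measurable lborel" by measurable
  let ?F = "cbox (vec (-1/2)) (vec (-1/2 + 1)) - box (vec (-1/2)) (vec (-1/2 + 1)) :: (real^2) set"
  have "?F \<in> null_sets lebesgue"
    using negligible_frontier_interval negligible_iff_null_sets by blast
  hence "?F \<in> null_sets lborel" by (subst (asm) null_sets_completion_iff) auto
  hence "AE z in lborel. z \<notin> ?F" by (rule AE_not_in)
  thus "AE z in lborel. indicator tile z * f z = indicator (square (-1/2)) z * f z"
  proof eventually_elim
    case (elim z)
    have "box (vec (-1/2)) (vec (-1/2 + 1)) \<subseteq> tile"
      by (auto simp: tile_def mem_box_cart less_imp_le)
    hence "z \<in> tile \<longleftrightarrow> z \<in> square (-1/2)"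
      using elim tile_subset_square by (auto simp: square_def)
    thus ?case by (simp add: indicator_def)
  qed
qed

lemma integral_lborel_translate:
  fixes f :: "real^2 \<Rightarrow> real"
  assumes "f \<in> borel_measurable borel"
  shows "(LINT z|lborel. f (c + z)) = (LINT z|lborel. f z)"
  using assms by (subst (2) lborel_distr_plus[of c, symmetric]) (simp add: integral_distr)

lemma integral_lborel_reflect:
  fixes f :: "real^2 \<Rightarrow> real"
  assumes "f \<in> borel_measurable borel"
  shows "(LINT z|lborel. f (- z)) = (LINT z|lborel. f z)"
proof -
  have o: "orthogonal_transformation (uminus :: real^2 \<Rightarrow> real^2)"
    unfolding orthogonal_transformation_def by (auto intro!: linearI)
  show ?thesis
    using assms by (subst (2) lborel_distr_orthogonal[OF o, symmetric]) (simp add: integral_distr)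
qed

lemma sets_annulus [measurable]: "annulus R t \<in> sets borel"
proof -
  have "annulus R t = {y. R - t \<le> norm y} \<inter> {y. norm y \<le> R + t}" by (auto simp: annulus_def)
  thus ?thesis by simp
qed

lemma bounded_annulus: "bounded (annulus R t)"
  by (rule bounded_subset[of "cball 0 (R + t)"]) (auto simp: annulus_def)

lemma bump_periodic:
  assumes "k \<in> int_lattice"
  shows "bump (k + z) = bump z"
proof -
  have "cos (2*pi*((k + z) $ i)) = cos (2*pi*(z $ i))" for i
  proof -
    obtain n where "k $ i = of_int n" using assms by (auto simp: int_lattice_def elim: Ints_cases)
    thus ?thesis by (simp add: distrib_left cos_add cos_int_2pin sin_int_2pin)
  qed
  thus ?thesis by (simp only: bump_def)
qed

text \<open>
  The convolution of the lattice point count with the normalised periodic kernel. By periodicity of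
  the kernel, the sum over lattice points and the integral over one period combine into a single
  integral over the annulus. In this form the Fourier expansion is immediate; the relation to the
  count is \<open>smoothed_count_tiles\<close>.
\<close>

definition smoothed_count :: "real \<Rightarrow> real \<Rightarrow> nat \<Rightarrow> real^2 \<Rightarrow> real" where
  "smoothed_count R t N x = (LINT z|lborel. indicator (annulus R t) z * bump (z - x) ^ N) / bump_mass N"

text \<open>
  Cutting the plane into tiles undoes the unfolding. Each summand is a local average of the indicator
  of the annulus around \<open>k + x\<close>.
\<close>

lemma smoothed_count_tiles:
  assumes K: "finite K" "K \<subseteq> int_lattice"
    and cover: "\<And>z. z + x \<in> annulus R t \<Longrightarrow> nearest_lattice_point z \<in> K"
  shows "smoothed_count R t N x =
    (\<Sum>k\<in>K. (LINT z|lborel. indicator tile z * (indicator (annulus R t) (z + (k + x)) * bump z ^ N)) / bump_mass N)"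
proof -
  have meas: "(\<lambda>z. indicator (annulus R t) z * bump (z - x) ^ N) \<in> borel_measurable borel" by measurable
  have part: "indicator (annulus R t) (x + z) * bump z ^ N =
      (\<Sum>k\<in>K. indicator tile (z - k) * (indicator (annulus R t) (x + z) * bump z ^ N))" for z
  proof (cases "z + x \<in> annulus R t")
    case True
    have "(\<Sum>k\<in>K. indicator tile (z - k) :: real) = (\<Sum>k\<in>K. if k = nearest_lattice_point z then 1 else 0)"
      using K by (intro sum.cong) (auto simp: indicator_def diff_in_tile_iff subset_eq)
    also have "\<dots> = 1" using K cover[OF True] by simp
    finally show ?thesis by (simp flip: sum_distrib_right)
  qed (simp add: add.commute)
  have shifted: "(LINT z|lborel. indicator tile (z - k) * (indicator (annulus R t) (x + z) * bump z ^ N)) =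
      (LINT z|lborel. indicator tile z * (indicator (annulus R t) (z + (k + x)) * bump z ^ N))"
    if "k \<in> K" for k
  proof -
    have "(\<lambda>z. indicator tile (z - k) * (indicator (annulus R t) (x + z) * bump z ^ N)) \<in> borel_measurable borel"
      by measurable
    note eq = integral_lborel_translate[OF this, of k]
    have "k \<in> int_lattice" using that K by blast
    moreover have "k + z - k = z" "x + (k + z) = z + (k + x)" for z by (simp_all add: algebra_simps)
    ultimately show ?thesis unfolding eq[symmetric] by (simp only: bump_periodic)
  qed
  have int: "integrable lborel (\<lambda>z. indicator tile (z - k) * (indicator (annulus R t) (x + z) * bump z ^ N))" for k
  proof -
    have "(\<lambda>z. indicator tile (z - k) * bump z ^ N) \<in> borel_measurable borel" by measurable
    moreover have "{z. x + z \<in> annulus R t} \<in> sets borel"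
      using measurable_sets[of "(+) x" borel borel "annulus R t"] sets_annulus by (simp add: vimage_def)
    moreover have "bounded {z. x + z \<in> annulus R t}"
    proof -
      have "norm z \<le> norm x + (R + t)" if "x + z \<in> annulus R t" for z
        using norm_triangle_ineq4[of "x + z" x] that by (simp add: annulus_def)
      thus ?thesis by (intro boundedI[of _ "norm x + (R + t)"]) simp
    qed
    ultimately have "integrable lborel (\<lambda>z. indicator {z. x + z \<in> annulus R t} z * (indicator tile (z - k) * bump z ^ N))"
      by (intro integrable_indicator_bounded[where B=1])
         (auto simp: indicator_def power_le_one bump_nonneg bump_le_1)
    thus ?thesis by (simp add: indicator_def mult_ac cong: if_cong)
  qed
  have "(LINT z|lborel. indicator (annulus R t) z * bump (z - x) ^ N) =
      (LINT z|lborel. indicator (annulus R t) (x + z) * bump z ^ N)"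
    using integral_lborel_translate[OF meas, of x] by simp
  also have "\<dots> = (\<Sum>k\<in>K. LINT z|lborel. indicator tile (z - k) * (indicator (annulus R t) (x + z) * bump z ^ N))"
    by (subst part) (rule Bochner_Integration.integral_sum[OF int])
  also have "\<dots> = (\<Sum>k\<in>K. LINT z|lborel. indicator tile z * (indicator (annulus R t) (z + (k + x)) * bump z ^ N))"
    using shifted by (rule sum.cong[OF refl])
  finally show ?thesis by (simp add: smoothed_count_def sum_divide_distrib)
qed

lemma integrable_tile_bump:
  "integrable lborel (\<lambda>z. indicator tile z * (indicator (annulus R t) (z + w) * bump z ^ N))"
proof (rule integrable_indicator_bounded[where B=1])
  show "bounded tile" using tile_subset_square by (rule bounded_subset[rotated]) (simp add: square_def)
qed (auto simp: indicator_def power_le_one bump_nonneg bump_le_1)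

lemma tile_average_bounds:
  "0 \<le> (LINT z|lborel. indicator tile z * (indicator (annulus R t) (z + w) * bump z ^ N)) / bump_mass N"
  "(LINT z|lborel. indicator tile z * (indicator (annulus R t) (z + w) * bump z ^ N)) / bump_mass N \<le> 1"
proof -
  show "0 \<le> (LINT z|lborel. indicator tile z * (indicator (annulus R t) (z + w) * bump z ^ N)) / bump_mass N"
    by (intro divide_nonneg_pos bump_mass_pos integral_nonneg_AE AE_I2) (simp add: bump_nonneg)
  have "(LINT z|lborel. indicator tile z * (indicator (annulus R t) (z + w) * bump z ^ N)) \<le> bump_mass N"
    unfolding bump_mass_def
    by (intro integral_mono integrable_tile_bump integrable_square continuous_intros)
       (use tile_subset_square in \<open>auto simp: indicator_def bump_nonneg\<close>)
  thus "(LINT z|lborel. indicator tile z * (indicator (annulus R t) (z + w) * bump z ^ N)) / bump_mass N \<le> 1"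
    using bump_mass_pos[of N] by simp
qed

text \<open>
  Off the two boundary circles the indicator is constant near \<open>w\<close>, so only the part of the kernel at
  distance at least \<open>\<delta>\<close> from the origin contributes to the error.
\<close>

lemma tile_average_tendsto:
  assumes "norm w \<noteq> R - t" "norm w \<noteq> R + t"
  shows "(\<lambda>N. (LINT z|lborel. indicator tile z * (indicator (annulus R t) (z + w) * bump z ^ N)) / bump_mass N)
    \<longlonglongrightarrow> indicator (annulus R t) w"
proof -
  define \<delta> where "\<delta> = min \<bar>norm w - (R - t)\<bar> \<bar>norm w - (R + t)\<bar>"
  have \<delta>: "\<delta> > 0" using assms by (simp add: \<delta>_def)
  let ?K = "square (-1/2) - ball 0 \<delta>"
  let ?a = "indicator (annulus R t) w :: real"
  let ?g = "\<lambda>N. (LINT z|lborel. indicator tile z * (indicator (annulus R t) (z + w) * bump z ^ N)) / bump_mass N"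
  have const: "indicator (annulus R t) (z + w) = ?a" if "norm z < \<delta>" for z
  proof -
    have "\<bar>norm (z + w) - norm w\<bar> \<le> norm z" using norm_triangle_ineq3[of "z + w" w] by simp
    hence "z + w \<in> annulus R t \<longleftrightarrow> w \<in> annulus R t"
      using that unfolding annulus_def \<delta>_def mem_Collect_eq by linarith
    thus ?thesis by (simp add: indicator_def)
  qed
  have intt: "integrable lborel (\<lambda>z. indicator tile z * (?a * bump z ^ N))" for N
  proof (rule integrable_indicator_bounded[where B=1])
    show "bounded tile" using tile_subset_square by (rule bounded_subset[rotated]) (simp add: square_def)
  qed (auto simp: indicator_def power_le_one bump_nonneg bump_le_1)
  have intK: "integrable lborel (\<lambda>z. indicator ?K z * bump z ^ N)" for N
    by (rule integrable_indicator_bounded[where B=1])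
       (auto simp: square_def bounded_diff power_le_one bump_nonneg bump_le_1)
  have bnd: "\<bar>?g N - ?a\<bar> \<le> (LINT z|lborel. indicator ?K z * bump z ^ N) / bump_mass N" for N
  proof -
    have "(LINT z|lborel. indicator tile z * (?a * bump z ^ N)) = ?a * bump_mass N"
    proof -
      have "(LINT z|lborel. indicator tile z * (?a * bump z ^ N)) =
          (LINT z|lborel. indicator (square (-1/2)) z * (?a * bump z ^ N))"
        by (rule integral_tile_eq_square) measurable
      also have "\<dots> = (LINT z|lborel. ?a * (indicator (square (-1/2)) z * bump z ^ N))"
        by (simp only: mult.left_commute)
      finally show ?thesis by (simp add: bump_mass_def)
    qed
    hence "?g N - ?a = ((LINT z|lborel. indicator tile z * (indicator (annulus R t) (z + w) * bump z ^ N)) -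
        (LINT z|lborel. indicator tile z * (?a * bump z ^ N))) / bump_mass N"
      using bump_mass_pos[of N] by (simp add: diff_divide_distrib)
    also have "\<dots> = (LINT z|lborel. indicator tile z * (indicator (annulus R t) (z + w) * bump z ^ N)
          - indicator tile z * (?a * bump z ^ N)) / bump_mass N"
      by (simp only: Bochner_Integration.integral_diff[OF integrable_tile_bump intt])
    finally have "\<bar>?g N - ?a\<bar> = \<bar>LINT z|lborel. indicator tile z * (indicator (annulus R t) (z + w) * bump z ^ N)
          - indicator tile z * (?a * bump z ^ N)\<bar> / bump_mass N"
      using bump_mass_pos[of N] by simp
    moreover have "\<bar>LINT z|lborel. indicator tile z * (indicator (annulus R t) (z + w) * bump z ^ N)
          - indicator tile z * (?a * bump z ^ N)\<bar> \<le> (LINT z|lborel. indicator ?K z * bump z ^ N)"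
    proof (rule order_trans[OF integral_abs_bound integral_mono[OF _ intK]])
      show "integrable lborel (\<lambda>z. \<bar>indicator tile z * (indicator (annulus R t) (z + w) * bump z ^ N)
          - indicator tile z * (?a * bump z ^ N)\<bar>)"
        by (intro integrable_abs Bochner_Integration.integrable_diff integrable_tile_bump intt)
      fix z :: "real^2"
      show "\<bar>indicator tile z * (indicator (annulus R t) (z + w) * bump z ^ N)
          - indicator tile z * (?a * bump z ^ N)\<bar> \<le> indicator ?K z * bump z ^ N"
      proof (cases "z \<in> tile \<and> norm z \<ge> \<delta>")
        case True
        hence "z \<in> ?K" using tile_subset_square by auto
        thus ?thesis using True bump_nonneg[of z] by (auto simp: indicator_def)
      next
        case False
        hence zero: "indicator tile z * (indicator (annulus R t) (z + w) * bump z ^ N)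
          - indicator tile z * (?a * bump z ^ N) = 0"
          using const[of z] by (cases "z \<in> tile") simp_all
        show ?thesis unfolding zero using bump_nonneg[of z] by simp
      qed
    qed
    ultimately show ?thesis using bump_mass_pos[of N] by (simp add: divide_right_mono)
  qed
  have "(\<lambda>N. ?g N - ?a) \<longlonglongrightarrow> 0"
    by (rule Lim_null_comparison[OF _ bump_concentrates[OF \<delta>]])
       (use bnd in \<open>auto intro!: always_eventually\<close>)
  thus ?thesis by (rule LIM_zero_cancel)
qed

text \<open>
  The constant term of the expansion is the area, because the kernel has mean 1. The sine parts
  vanish because the annulus is symmetric.
\<close>

lemma smoothed_count_expansion:
  obtains S b where "finite S" "S \<subseteq> int_lattice - {0}" "\<And>m. m \<in> S \<Longrightarrow> \<bar>b m\<bar> \<le> 2 * \<bar>annulus_coeff R t m\<bar>"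
    "\<And>x. smoothed_count R t N x - measure lebesgue (annulus R t) = cos_poly S b x"
proof -
  obtain S b where S: "finite S" "S \<subseteq> int_lattice" "0 \<in> S" "b 0 = 1"
    and b: "\<And>m. m \<in> S \<Longrightarrow> 0 \<le> b m \<and> b m \<le> 2"
    and exp: "\<And>z. bump z ^ N = bump_mass N * cos_poly S b z"
    using bump_power_coefficients[of N] by blast
  let ?A = "annulus R t"
  have meas_sin: "(\<lambda>z. indicator ?A z * sin (2*pi*(m \<bullet> z))) \<in> borel_measurable borel"
    and meas_cos: "(\<lambda>z. indicator ?A z * cos (2*pi*(m \<bullet> z))) \<in> borel_measurable borel" for m
    by (auto intro!: borel_measurable_times borel_measurable_indicator
        borel_measurable_continuous_onI continuous_intros)
  have int_sin: "integrable lborel (\<lambda>z. indicator ?A z * sin (2*pi*(m \<bullet> z)))"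
    and int_cos: "integrable lborel (\<lambda>z. indicator ?A z * cos (2*pi*(m \<bullet> z)))" for m
    by (auto intro!: integrable_indicator_bounded[where B=1] bounded_annulus
        borel_measurable_continuous_onI continuous_intros)
  have sin0: "(LINT z|lborel. indicator ?A z * sin (2*pi*(m \<bullet> z))) = 0" for m
  proof -
    have "(LINT z|lborel. indicator ?A z * sin (2*pi*(m \<bullet> z))) =
        (LINT z|lborel. - (indicator ?A z * sin (2*pi*(m \<bullet> z))))"
      by (subst integral_lborel_reflect[OF meas_sin, symmetric])
         (simp add: annulus_def indicator_def)
    thus ?thesis by simp
  qed
  have coeff: "(LINT z|lborel. indicator ?A z * cos (2*pi*(m \<bullet> (z - x)))) =
      annulus_coeff R t m * cos (2*pi*(m \<bullet> x))" for m x
  proof -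
    have pt: "indicator ?A z * cos (2*pi*(m \<bullet> (z - x))) =
        cos (2*pi*(m \<bullet> x)) * (indicator ?A z * cos (2*pi*(m \<bullet> z)))
          + sin (2*pi*(m \<bullet> x)) * (indicator ?A z * sin (2*pi*(m \<bullet> z)))" for z
      by (simp add: inner_diff_right right_diff_distrib cos_diff distrib_left mult_ac)
    have "(LINT z|lborel. indicator ?A z * cos (2*pi*(m \<bullet> (z - x)))) =
        cos (2*pi*(m \<bullet> x)) * (LINT z|lborel. indicator ?A z * cos (2*pi*(m \<bullet> z)))
          + sin (2*pi*(m \<bullet> x)) * (LINT z|lborel. indicator ?A z * sin (2*pi*(m \<bullet> z)))"
      unfolding pt using int_sin[of m] int_cos[of m]
      by (subst Bochner_Integration.integral_add) (auto intro: integrable_mult_right)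
    thus ?thesis unfolding sin0 annulus_coeff_def by (simp only: mult.commute[of "cos _"] mult_zero_right add_0_right)
  qed
  have int_shift: "integrable lborel (\<lambda>z. b m * (indicator ?A z * cos (2*pi*(m \<bullet> (z - x)))))" for m x
    by (intro integrable_mult_right integrable_indicator_bounded[where B=1] bounded_annulus
        borel_measurable_continuous_onI continuous_intros) auto
  have coeff0: "annulus_coeff R t 0 = measure lebesgue ?A"
    by (simp add: annulus_coeff_def)
  have "smoothed_count R t N x = cos_poly S (\<lambda>m. b m * annulus_coeff R t m) x" for x
  proof -
    have "(LINT z|lborel. indicator ?A z * bump (z - x) ^ N) =
       (LINT z|lborel. bump_mass N * (\<Sum>m\<in>S. b m * (indicator ?A z * cos (2*pi*(m \<bullet> (z - x))))))"
      unfolding exp cos_poly_def by (simp add: sum_distrib_left mult_ac)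
    also have "\<dots> = bump_mass N * (\<Sum>m\<in>S. b m * (LINT z|lborel. indicator ?A z * cos (2*pi*(m \<bullet> (z - x)))))"
      using int_shift by (simp add: Bochner_Integration.integral_sum)
    also have "\<dots> = bump_mass N * cos_poly S (\<lambda>m. b m * annulus_coeff R t m) x"
      by (simp only: coeff) (simp only: cos_poly_def mult.assoc)
    finally show ?thesis
      using bump_mass_pos[of N] by (simp add: smoothed_count_def)
  qed
  hence *: "smoothed_count R t N x - measure lebesgue ?A = cos_poly (S - {0}) (\<lambda>m. b m * annulus_coeff R t m) x" for x
    unfolding cos_poly_def using S by (subst (asm) sum.remove[of S 0]) (auto simp: coeff0)
  show ?thesis
  proof (rule that[of "S - {0}" "\<lambda>m. b m * annulus_coeff R t m"])
    fix m assume "m \<in> S - {0}"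
    thus "\<bar>b m * annulus_coeff R t m\<bar> \<le> 2 * \<bar>annulus_coeff R t m\<bar>"
      using b[of m] by (auto simp: abs_mult intro!: mult_right_mono)
  qed (use S * in auto)
qed

lemma norm_unit_square:
  assumes "x \<in> unit_square" shows "norm x \<le> 2"
proof -
  have "\<bar>x $ i\<bar> \<le> 1" for i using assms by (simp add: unit_square_def)
  hence "(\<Sum>i\<in>UNIV. \<bar>x $ i\<bar>) \<le> (\<Sum>i\<in>(UNIV :: 2 set). 1)" by (intro sum_mono)
  thus ?thesis using norm_le_l1_cart[of x] by simp
qed

text \<open>
  The radius of summation may be enlarged, so that all the counts that occur together can be written
  as sums over one finite set of lattice points.
\<close>

lemma annulus_discrepancy_eq_sum:
  assumes x: "x \<in> unit_square" and B: "B \<ge> R + t + 2"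
  shows "annulus_discrepancy x R t =
    (\<Sum>k\<in>{k \<in> int_lattice. norm k \<le> B}. indicator (annulus R t) (k + x)) - measure lebesgue (annulus R t)"
proof -
  have nx: "norm x \<le> 2" by (rule norm_unit_square[OF x])
  have "(\<Sum>k\<in>{k \<in> int_lattice. norm k \<le> R + t + 2}. indicator (annulus R t) (k + x) :: real) =
      (\<Sum>k\<in>{k \<in> int_lattice. norm k \<le> B}. indicator (annulus R t) (k + x))"
  proof (rule sum.mono_neutral_left[OF finite_int_lattice_bounded])
    show "\<forall>k\<in>{k \<in> int_lattice. norm k \<le> B} - {k \<in> int_lattice. norm k \<le> R + t + 2}.
        indicator (annulus R t) (k + x) = (0 :: real)"
    proof
      fix k assume k: "k \<in> {k \<in> int_lattice. norm k \<le> B} - {k \<in> int_lattice. norm k \<le> R + t + 2}"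
      have "norm k \<le> norm (k + x) + norm x" using norm_triangle_ineq4[of "k + x" x] by simp
      thus "indicator (annulus R t) (k + x) = (0 :: real)"
        using k nx by (auto simp: annulus_def indicator_def)
    qed
  qed (use B in auto)
  thus ?thesis using annulus_discrepancy_eq[OF x] by simp
qed

text \<open>
  Dominated convergence: for almost every \<open>x\<close>, no lattice translate of \<open>x\<close> lies on a boundary circle,
  and there the smoothed counts tend to the count; they are bounded by the number of relevant lattice
  points.
\<close>

lemma annulus_moment_le:
  assumes q: "q > 0"
    and M: "\<And>N. (LINT x|lborel. indicator unit_square x *
        \<bar>smoothed_count R t N x - measure lebesgue (annulus R t)\<bar> powr q) \<le> M"
  shows "(LINT x:unit_square|lebesgue. \<bar>annulus_discrepancy x R t\<bar> powr q) \<le> M"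
proof -
  let ?A = "annulus R t"
  let ?a = "measure lebesgue ?A"
  define K where "K = {k \<in> int_lattice. norm k \<le> R + t + 4}"
  have K: "finite K" "K \<subseteq> int_lattice" by (auto simp: K_def finite_int_lattice_bounded)
  let ?s = "\<lambda>N x. indicator unit_square x * \<bar>smoothed_count R t N x - ?a\<bar> powr q"
  let ?f = "\<lambda>x. indicator unit_square x *\<^sub>R \<bar>annulus_discrepancy x R t\<bar> powr q"
  have tiles: "smoothed_count R t N x =
    (\<Sum>k\<in>K. (LINT z|lborel. indicator tile z * (indicator ?A (z + (k + x)) * bump z ^ N)) / bump_mass N)"
    if x: "x \<in> unit_square" for x N
  proof (rule smoothed_count_tiles[OF K])
    fix z assume z: "z + x \<in> ?A"
    have "norm z \<le> R + t + 2"
      using norm_unit_square[OF x] norm_triangle_ineq4[of "z + x" x] z by (simp add: annulus_def)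
    thus "nearest_lattice_point z \<in> K"
      using norm_nearest_lattice_point[of z] nearest_lattice_point_in[of z] by (simp add: K_def)
  qed
  have meas_s: "?s N \<in> borel_measurable borel" for N
  proof -
    obtain S b where eq: "\<And>x. smoothed_count R t N x - ?a = cos_poly S b x"
      using smoothed_count_expansion[of R t N] by metis
    show ?thesis unfolding unit_square_eq eq by measurable
  qed
  have bound: "\<bar>smoothed_count R t N x - ?a\<bar> \<le> real (card K) + ?a" if x: "x \<in> unit_square" for x N
  proof -
    have "0 \<le> smoothed_count R t N x"
      unfolding tiles[OF x] by (intro sum_nonneg tile_average_bounds)
    moreover have "smoothed_count R t N x \<le> (\<Sum>k\<in>K. 1)"
      unfolding tiles[OF x] by (intro sum_mono tile_average_bounds)
    moreover have "\<bar>s - a\<bar> \<le> c + a" if "0 \<le> s" "s \<le> c" "0 \<le> a" for s a c :: real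
      using that by linarith
    ultimately show ?thesis using measure_nonneg by simp
  qed
  have lim: "(\<lambda>N. ?s N x) \<longlonglongrightarrow> ?f x" if x: "\<forall>k\<in>K. norm (k + x) \<noteq> R - t \<and> norm (k + x) \<noteq> R + t" for x
  proof (cases "x \<in> unit_square")
    case True
    have "(\<lambda>N. smoothed_count R t N x) \<longlonglongrightarrow> (\<Sum>k\<in>K. indicator ?A (k + x))"
      unfolding tiles[OF True] using x by (intro tendsto_sum tile_average_tendsto) auto
    moreover have "annulus_discrepancy x R t = (\<Sum>k\<in>K. indicator ?A (k + x)) - ?a"
      unfolding K_def by (rule annulus_discrepancy_eq_sum[OF True]) simp
    ultimately have "(\<lambda>N. smoothed_count R t N x - ?a) \<longlonglongrightarrow> annulus_discrepancy x R t"
      by (simp only:) (intro tendsto_diff tendsto_const)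
    hence "(\<lambda>N. \<bar>smoothed_count R t N x - ?a\<bar>) \<longlonglongrightarrow> \<bar>annulus_discrepancy x R t\<bar>"
      by (rule tendsto_rabs)
    hence "(\<lambda>N. \<bar>smoothed_count R t N x - ?a\<bar> powr q) \<longlonglongrightarrow> \<bar>annulus_discrepancy x R t\<bar> powr q"
      using q by (intro tendsto_powr') auto
    thus ?thesis using True by simp
  qed simp
  have ae: "AE x in lebesgue. (\<lambda>N. ?s N x) \<longlonglongrightarrow> ?f x"
  proof (rule AE_completion)
    have "AE x in lborel. \<forall>k\<in>K. norm (k + x) \<noteq> R - t \<and> norm (k + x) \<noteq> R + t"
      using AE_norm_neq by (intro AE_finite_allI[OF K(1)] AE_conjI)
    thus "AE x in lborel. (\<lambda>N. ?s N x) \<longlonglongrightarrow> ?f x" by eventually_elim (rule lim)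
  qed
  let ?w = "\<lambda>x. indicator unit_square x * (real (card K) + ?a) powr q"
  have "(\<lambda>N. integral\<^sup>L lebesgue (?s N)) \<longlonglongrightarrow> integral\<^sup>L lebesgue ?f"
  proof (rule integral_dominated_convergence[where w="?w"])
    show "?f \<in> borel_measurable lebesgue"
      using annulus_discrepancy_norm_integrable[OF q, of R t]
      unfolding set_integrable_def by (rule borel_measurable_integrable)
    show "?s N \<in> borel_measurable lebesgue" for N
      using meas_s[of N] by (intro measurable_completion) simp
    have "integrable lborel ?w"
      unfolding unit_square_eq by (intro integrable_square continuous_intros)
    thus "integrable lebesgue ?w" by (subst integrable_completion) auto
    show "AE x in lebesgue. norm (?s N x) \<le> ?w x" for N
      using bound q by (intro AE_I2) (auto simp: indicator_def intro!: powr_mono2)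
  qed (rule ae)
  moreover have "integral\<^sup>L lebesgue (?s N) \<le> M" for N
    using M[of N] meas_s[of N] by (subst integral_completion) simp_all
  ultimately have "integral\<^sup>L lebesgue ?f \<le> M"
    by (intro LIMSEQ_le_const2[of _ _ M]) auto
  thus ?thesis by (simp add: set_lebesgue_integral_def)
qed

section \<open>Dyadic decomposition of cosine polynomials\<close>

text \<open>
  Interpolation between the supremum \<open>n * \<beta>\<close> and the second moment \<open>n * \<beta>\<^sup>2\<close>.
\<close>

lemma cos_poly_Lq_bound:
  assumes S: "finite S" "S \<subseteq> int_lattice" and a: "\<And>m. m \<in> S \<Longrightarrow> \<bar>a m\<bar> \<le> \<beta>"
    and n: "real (card S) \<le> n" and pos: "0 < n" "0 < \<beta>" and q: "2 \<le> q"
  shows "(LINT z|lborel. indicator (square \<alpha>) z * \<bar>cos_poly S a z\<bar> powr q) \<le> (n powr (1 - 1/q) * \<beta>) powr q"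
proof -
  have sup: "\<bar>cos_poly S a z\<bar> \<le> n * \<beta>" for z
  proof -
    have "\<bar>cos_poly S a z\<bar> \<le> (\<Sum>m\<in>S. \<bar>a m\<bar>)" by (rule cos_poly_bound)
    also have "\<dots> \<le> (\<Sum>m\<in>S. \<beta>)" by (intro sum_mono a)
    also have "\<dots> \<le> n * \<beta>" using n pos by (simp add: mult_right_mono)
    finally show ?thesis .
  qed
  have pt: "\<bar>cos_poly S a z\<bar> powr q \<le> (n * \<beta>) powr (q - 2) * (cos_poly S a z)\<^sup>2" for z
  proof (cases "cos_poly S a z = 0")
    case False
    hence "\<bar>cos_poly S a z\<bar> powr q = \<bar>cos_poly S a z\<bar> powr (q - 2) * \<bar>cos_poly S a z\<bar> powr 2"
      by (subst powr_add[symmetric]) simp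
    also have "\<bar>cos_poly S a z\<bar> powr 2 = (cos_poly S a z)\<^sup>2" using False by simp
    finally show ?thesis using sup[of z] q by (auto intro!: mult_right_mono powr_mono2)
  qed (use q in simp)
  have "(LINT z|lborel. indicator (square \<alpha>) z * \<bar>cos_poly S a z\<bar> powr q) \<le>
      (LINT z|lborel. indicator (square \<alpha>) z * ((n * \<beta>) powr (q - 2) * (cos_poly S a z)\<^sup>2))"
  proof (rule integral_mono)
    show "integrable lborel (\<lambda>z. indicator (square \<alpha>) z * \<bar>cos_poly S a z\<bar> powr q)"
      using q by (intro integrable_square continuous_on_powr' continuous_intros) auto
    show "integrable lborel (\<lambda>z. indicator (square \<alpha>) z * ((n * \<beta>) powr (q - 2) * (cos_poly S a z)\<^sup>2))"
      by (intro integrable_square continuous_intros)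
  qed (auto simp: indicator_def pt)
  also have "\<dots> = (n * \<beta>) powr (q - 2) * (LINT z|lborel. indicator (square \<alpha>) z * (cos_poly S a z)\<^sup>2)"
    by (simp only: mult.left_commute[of _ "(n * \<beta>) powr (q - 2)"] integral_mult_right_zero)
  also have "\<dots> \<le> (n * \<beta>) powr (q - 2) * (n * \<beta>\<^sup>2)"
  proof (rule mult_left_mono)
    have "(LINT z|lborel. indicator (square \<alpha>) z * (cos_poly S a z)\<^sup>2) \<le> real (card S) * \<beta>\<^sup>2"
      using S a by (rule cos_poly_L2_bound)
    also have "\<dots> \<le> n * \<beta>\<^sup>2" using n by (rule mult_right_mono) simp
    finally show "(LINT z|lborel. indicator (square \<alpha>) z * (cos_poly S a z)\<^sup>2) \<le> n * \<beta>\<^sup>2" .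
  qed simp
  also have "n * \<beta>\<^sup>2 = n powr 1 * \<beta> powr 2" using pos by simp
  also have "(n * \<beta>) powr (q - 2) * (n powr 1 * \<beta> powr 2) = n powr (q - 1) * \<beta> powr q"
    using pos by (simp add: powr_mult powr_diff powr_realpow field_simps power2_eq_square)
  also have "\<dots> = (n powr (1 - 1/q) * \<beta>) powr q"
    using pos q by (simp add: powr_mult powr_powr left_diff_distrib)
  finally show ?thesis .
qed

lemma convex_on_powr_nonneg:
  fixes q :: real
  assumes q: "1 \<le> q" shows "convex_on {0..} (\<lambda>x. x powr q)"
proof (rule convex_onI)
  fix t x y :: real assume t: "0 < t" "t < 1" and xy: "x \<in> {0..}" "y \<in> {0..}"
  have scale: "(c * z) powr q \<le> c * z powr q" if "0 < c" "c < 1" "0 \<le> z" for c z :: real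
  proof -
    have "c powr q \<le> c" using powr_mono'[of 1 q c] q that by simp
    thus ?thesis using that by (simp add: powr_mult mult_right_mono)
  qed
  show "((1 - t) *\<^sub>R x + t *\<^sub>R y) powr q \<le> (1 - t) * x powr q + t * y powr q"
  proof (cases "x = 0 \<or> y = 0")
    case True
    thus ?thesis using scale[of t y] scale[of "1 - t" x] t xy q by auto
  next
    case False
    thus ?thesis using convex_onD[OF powr_convex[OF q], of t x y] t xy by simp
  qed
qed simp

lemma abs_sum_powr_convex:
  fixes f w :: "'i \<Rightarrow> real"
  assumes J: "finite J" "J \<noteq> {}" and w: "\<And>j. j \<in> J \<Longrightarrow> 0 < w j" "sum w J = 1" and q: "1 \<le> q"
  shows "\<bar>\<Sum>j\<in>J. f j\<bar> powr q \<le> (\<Sum>j\<in>J. w j * (\<bar>f j\<bar> / w j) powr q)"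
proof -
  have "\<bar>\<Sum>j\<in>J. f j\<bar> \<le> (\<Sum>j\<in>J. w j *\<^sub>R (\<bar>f j\<bar> / w j))"
    by (rule order_trans[OF sum_abs]) (auto intro!: sum_mono simp: less_imp_neq[OF w(1), symmetric])
  hence "\<bar>\<Sum>j\<in>J. f j\<bar> powr q \<le> (\<Sum>j\<in>J. w j *\<^sub>R (\<bar>f j\<bar> / w j)) powr q"
    using q by (intro powr_mono2) auto
  also have "\<dots> \<le> (\<Sum>j\<in>J. w j * (\<bar>f j\<bar> / w j) powr q)"
    using convex_on_sum[OF J convex_on_powr_nonneg[OF q] w(2), of "\<lambda>j. \<bar>f j\<bar> / w j"] w(1)
    by (simp add: less_imp_le)
  finally show ?thesis .
qed

text \<open>
  Minkowski's inequality for finitely many functions. It follows from Jensen's inequality for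
  \<open>x powr q\<close> with weights \<open>w j\<close> proportional to the norm bounds \<open>c j\<close>.
\<close>

lemma Lq_triangle_inequality:
  fixes c :: "'i \<Rightarrow> real"
  assumes J: "finite J" and c: "\<And>j. j \<in> J \<Longrightarrow> 0 < c j" and q: "1 \<le> q"
    and f: "\<And>j. j \<in> J \<Longrightarrow> continuous_on UNIV (f j)"
    and M: "\<And>j. j \<in> J \<Longrightarrow> (LINT z|lborel. indicator (square \<alpha>) z * \<bar>f j z\<bar> powr q) \<le> c j powr q"
  shows "(LINT z|lborel. indicator (square \<alpha>) z * \<bar>\<Sum>j\<in>J. f j z\<bar> powr q) \<le> (\<Sum>j\<in>J. c j) powr q"
proof (cases "J = {}")
  case False
  define s where "s = (\<Sum>j\<in>J. c j)"
  have s: "s > 0" unfolding s_def by (intro sum_pos J False c)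
  define w where "w j = c j / s" for j
  have w: "\<And>j. j \<in> J \<Longrightarrow> 0 < w j" "sum w J = 1"
    using c s by (auto simp: w_def s_def simp flip: sum_divide_distrib)
  have int: "integrable lborel (\<lambda>z. indicator (square \<alpha>) z * \<bar>f j z\<bar> powr q)" if "j \<in> J" for j
    using q f[OF that] by (intro integrable_square continuous_on_powr' continuous_intros) auto
  have wq: "w j * (y / w j) powr q = (w j * (1 / w j) powr q) * y powr q" if "j \<in> J" "y \<ge> 0" for j y
    using w(1)[OF that(1)] that(2) by (simp add: powr_divide)
  have "(LINT z|lborel. indicator (square \<alpha>) z * \<bar>\<Sum>j\<in>J. f j z\<bar> powr q) \<le>
      (LINT z|lborel. (\<Sum>j\<in>J. (w j * (1 / w j) powr q) * (indicator (square \<alpha>) z * \<bar>f j z\<bar> powr q)))"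
  proof (rule integral_mono)
    show "integrable lborel (\<lambda>z. indicator (square \<alpha>) z * \<bar>\<Sum>j\<in>J. f j z\<bar> powr q)"
      using q f by (intro integrable_square continuous_on_powr' continuous_intros) auto
    show "integrable lborel (\<lambda>z. \<Sum>j\<in>J. (w j * (1 / w j) powr q) * (indicator (square \<alpha>) z * \<bar>f j z\<bar> powr q))"
      using int by (intro Bochner_Integration.integrable_sum integrable_mult_right) auto
    fix z
    have "\<bar>\<Sum>j\<in>J. f j z\<bar> powr q \<le> (\<Sum>j\<in>J. w j * (\<bar>f j z\<bar> / w j) powr q)"
      by (rule abs_sum_powr_convex[OF J False w q])
    also have "\<dots> = (\<Sum>j\<in>J. (w j * (1 / w j) powr q) * \<bar>f j z\<bar> powr q)"
      by (intro sum.cong refl wq) auto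
    finally show "indicator (square \<alpha>) z * \<bar>\<Sum>j\<in>J. f j z\<bar> powr q \<le>
        (\<Sum>j\<in>J. (w j * (1 / w j) powr q) * (indicator (square \<alpha>) z * \<bar>f j z\<bar> powr q))"
      by (simp add: indicator_def)
  qed
  also have "\<dots> = (\<Sum>j\<in>J. (w j * (1 / w j) powr q) * (LINT z|lborel. indicator (square \<alpha>) z * \<bar>f j z\<bar> powr q))"
    using int by (subst Bochner_Integration.integral_sum) auto
  also have "\<dots> \<le> (\<Sum>j\<in>J. (w j * (1 / w j) powr q) * c j powr q)"
    using M w by (intro sum_mono mult_left_mono) (auto simp: less_imp_le[OF w(1)])
  also have "\<dots> = (\<Sum>j\<in>J. w j * s powr q)"
  proof (rule sum.cong[OF refl])
    fix j assume j: "j \<in> J"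
    have eq: "c j / w j = s" using c[OF j] s by (simp add: w_def)
    show "w j * (1 / w j) powr q * c j powr q = w j * s powr q"
      using wq[OF j less_imp_le[OF c[OF j]]] by (simp only: eq)
  qed
  also have "\<dots> = s powr q" using w(2) by (simp flip: sum_distrib_right)
  finally show ?thesis by (simp add: s_def)
qed simp

text \<open>
  Each coordinate is an integer of absolute value at most \<open>2 ^ (j + 1)\<close>, which leaves
  \<open>4 * 2 ^ j + 1 \<le> 5 * 2 ^ j\<close> choices.
\<close>

lemma card_int_lattice_dyadic:
  "real (card {m \<in> int_lattice. norm m < 2 ^ (j + 1)}) \<le> 25 * 4 ^ j"
proof -
  let ?B = "{m \<in> int_lattice. norm m < 2 ^ (j + 1)}"
  define I :: "int set" where "I = {- (2 ^ (j + 1)) .. 2 ^ (j + 1)}"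
  let ?g = "\<lambda>m. (\<lfloor>m $ 1\<rfloor>, \<lfloor>m $ 2\<rfloor>)"
  have "inj_on ?g ?B"
  proof (rule inj_onI)
    fix m n assume "m \<in> ?B" "n \<in> ?B" and e: "?g m = ?g n"
    hence "m $ i \<in> \<int>" "n $ i \<in> \<int>" for i by (simp_all add: int_lattice_def)
    hence "of_int \<lfloor>m $ i\<rfloor> = m $ i" "of_int \<lfloor>n $ i\<rfloor> = n $ i" for i by (metis of_int_floor Ints_cases floor_of_int)+
    moreover have "\<lfloor>m $ 1\<rfloor> = \<lfloor>n $ 1\<rfloor>" "\<lfloor>m $ 2\<rfloor> = \<lfloor>n $ 2\<rfloor>" using e by simp_all
    ultimately have "m $ 1 = n $ 1" "m $ 2 = n $ 2" by metis+
    thus "m = n" by (simp add: vec_eq_iff forall_2)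
  qed
  moreover have "?g ` ?B \<subseteq> I \<times> I"
  proof
    fix p assume "p \<in> ?g ` ?B"
    then obtain m where m: "m \<in> ?B" "p = ?g m" by auto
    have "\<lfloor>m $ i\<rfloor> \<in> I" for i
    proof -
      have "\<bar>m $ i\<bar> \<le> 2 ^ (j + 1)" using m component_le_norm_cart[of m i] by auto
      hence "- (2 ^ (j + 1)) \<le> m $ i" "m $ i \<le> 2 ^ (j + 1)" by linarith+
      hence "of_int (- (2 ^ (j + 1))) \<le> m $ i" "m $ i \<le> of_int (2 ^ (j + 1))" by simp_all
      hence "- (2 ^ (j + 1)) \<le> \<lfloor>m $ i\<rfloor>" "\<lfloor>m $ i\<rfloor> \<le> 2 ^ (j + 1)"
        by (simp_all only: le_floor_iff, linarith)
      thus ?thesis by (simp add: I_def)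
    qed
    thus "p \<in> I \<times> I" using m by simp
  qed
  moreover have fin: "finite (I \<times> I)" by (simp add: I_def)
  ultimately have "card ?B \<le> card (I \<times> I)" by (meson card_inj_on_le)
  also have "card (I \<times> I) = (2 * 2 ^ (j + 1) + 1)\<^sup>2"
  proof -
    have "card I = nat (2 * 2 ^ (j + 1) + 1)" by (simp add: I_def)
    also have "\<dots> = 2 * 2 ^ (j + 1) + 1" by (simp add: nat_add_distrib nat_mult_distrib nat_power_eq)
    finally show ?thesis by (simp add: card_cartesian_product power2_eq_square)
  qed
  also have "\<dots> \<le> (5 * 2 ^ j)\<^sup>2" by (rule power_mono) auto
  also have "\<dots> = 25 * 4 ^ j" by (simp add: power2_eq_square flip: power_mult_distrib)
  finally have "real (card ?B) \<le> real (25 * 4 ^ j)" by (simp only: of_nat_le_iff)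
  thus ?thesis by simp
qed

lemma sum_powers_inj_le:
  fixes r :: real
  assumes "finite F" "inj_on \<phi> F" "0 \<le> r" "r < 1"
  shows "(\<Sum>j\<in>F. r ^ \<phi> j) \<le> 1 / (1 - r)"
proof -
  have "(\<Sum>j\<in>F. r ^ \<phi> j) = (\<Sum>i\<in>\<phi> ` F. r ^ i)" using assms(2) by (simp add: sum.reindex)
  also have "\<dots> \<le> (\<Sum>i. r ^ i)" using assms by (intro sum_le_suminf) auto
  also have "\<dots> = 1 / (1 - r)" using assms by (intro suminf_geometric) auto
  finally show ?thesis .
qed

text \<open>
  The summands increase geometrically while \<open>2 ^ j \<le> 1 / t\<close> and decrease geometrically afterwards, so the
  sum is comparable to its largest term. Both ratios stay away from 1 because \<open>0 < \<alpha> < 1\<close>.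
\<close>

lemma dyadic_sum_bound:
  fixes \<alpha> :: real
  assumes \<alpha>: "0 < \<alpha>" "\<alpha> < 1"
  obtains C where "C > 0"
    "\<And>F t. finite F \<Longrightarrow> 0 < t \<Longrightarrow> t < 1 \<Longrightarrow>
      (\<Sum>j\<in>F. 2 powr (\<alpha> * real j) * min t (2 powr (- real j))) \<le> C * t powr (1 - \<alpha>)"
proof -
  define r s where "r = 2 powr (-\<alpha>)" and "s = 2 powr (\<alpha> - 1)"
  have r: "0 < r" "r < 1" and s: "0 < s" "s < 1"
    using \<alpha> by (auto simp: r_def s_def powr_less_one)
  have r_pow: "r ^ i = 2 powr (-\<alpha> * real i)" and s_pow: "s ^ i = 2 powr ((\<alpha> - 1) * real i)" for i
    by (simp_all add: r_def s_def powr_power mult.commute)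
  show ?thesis
  proof (rule that[of "1 / (1 - r) + 1 / (1 - s)"])
    show "0 < 1 / (1 - r) + 1 / (1 - s)" using r s by (intro add_pos_pos) auto
    fix F :: "nat set" and t :: real assume F: "finite F" and t: "0 < t" "t < 1"
    define J where "J = nat \<lfloor>log 2 (1 / t)\<rfloor>"
    have "log 2 (1 / t) \<ge> 0" using t by simp
    hence J: "real J \<le> log 2 (1 / t)" "log 2 (1 / t) < real J + 1"
      unfolding J_def by linarith+
    \<comment> \<open>powers of \<open>t\<close> as powers of 2, so that all comparisons are between linear exponents\<close>
    define u where "u = log 2 (1 / t)"
    have tu: "t powr x = 2 powr (- u * x)" for x
    proof -
      have "2 powr (- u) = t" using t by (simp add: u_def log_divide)
      thus ?thesis by (metis powr_powr)
    qed
    let ?h = "\<lambda>j. 2 powr (\<alpha> * real j) * min t (2 powr (- real j))"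
    have low: "?h j \<le> t powr (1 - \<alpha>) * r ^ (J - j)" if "j \<le> J" for j
    proof -
      have "?h j \<le> 2 powr (\<alpha> * real j) * t powr 1" using t by (intro mult_left_mono) auto
      also have "\<dots> = 2 powr (\<alpha> * real j - u)" by (simp only: tu powr_add[symmetric]) simp
      also have "\<dots> \<le> 2 powr (- u * (1 - \<alpha>) + - \<alpha> * real (J - j))"
      proof (rule powr_mono)
        have "\<alpha> * real J \<le> \<alpha> * u" using J \<alpha> by (intro mult_left_mono) (auto simp: u_def)
        thus "\<alpha> * real j - u \<le> - u * (1 - \<alpha>) + - \<alpha> * real (J - j)"
          using that by (simp add: of_nat_diff algebra_simps)
      qed simp
      finally show ?thesis by (simp only: powr_add tu r_pow)
    qed
    have high: "?h j \<le> t powr (1 - \<alpha>) * s ^ (j - Suc J)" if "\<not> j \<le> J" for j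
    proof -
      have "?h j \<le> 2 powr (\<alpha> * real j) * 2 powr (- real j)" by (intro mult_left_mono) auto
      also have "\<dots> = 2 powr ((\<alpha> - 1) * real j)" by (simp add: powr_add[symmetric] algebra_simps)
      also have "\<dots> \<le> 2 powr (- u * (1 - \<alpha>) + (\<alpha> - 1) * real (j - Suc J))"
      proof (rule powr_mono)
        have "(1 - \<alpha>) * u \<le> (1 - \<alpha>) * (real J + 1)" using J \<alpha> by (intro mult_left_mono) (auto simp: u_def)
        thus "(\<alpha> - 1) * real j \<le> - u * (1 - \<alpha>) + (\<alpha> - 1) * real (j - Suc J)"
          using that by (simp add: of_nat_diff algebra_simps)
      qed simp
      finally show ?thesis by (simp only: powr_add tu s_pow)
    qed
    have "(\<Sum>j\<in>F. ?h j) = (\<Sum>j\<in>F \<inter> {..J}. ?h j) + (\<Sum>j\<in>F - {..J}. ?h j)"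
      using F by (rule sum.Int_Diff)
    also have "\<dots> \<le> (\<Sum>j\<in>F \<inter> {..J}. t powr (1 - \<alpha>) * r ^ (J - j)) + (\<Sum>j\<in>F - {..J}. t powr (1 - \<alpha>) * s ^ (j - Suc J))"
      by (intro add_mono sum_mono low high) auto
    also have "\<dots> = t powr (1 - \<alpha>) * ((\<Sum>j\<in>F \<inter> {..J}. r ^ (J - j)) + (\<Sum>j\<in>F - {..J}. s ^ (j - Suc J)))"
      by (simp add: sum_distrib_left distrib_left)
    also have "\<dots> \<le> t powr (1 - \<alpha>) * (1 / (1 - r) + 1 / (1 - s))"
      using F r s by (intro mult_left_mono add_mono sum_powers_inj_le) (auto simp: inj_on_def)
    finally show "(\<Sum>j\<in>F. ?h j) \<le> (1 / (1 - r) + 1 / (1 - s)) * t powr (1 - \<alpha>)"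
      by (simp add: mult.commute)
  qed
qed

text \<open>
  A block at scale \<open>2 ^ j\<close> has at most \<open>25 * 4 ^ j\<close> frequencies with coefficients at most
  \<open>\<beta> j = K * 2 powr (- j / 2) * min t (2 powr (- j))\<close>. By \<open>cos_poly_Lq_bound\<close> its norm is at most a
  constant times \<open>2 powr (j * (2 - 2/q)) * \<beta> j\<close>, which is where the exponent \<open>3/2 - 2/q\<close> comes from. The
  hypothesis on \<open>C\<close> is the conclusion of \<open>dyadic_sum_bound\<close> for this exponent.
\<close>

lemma cos_poly_Lq_dyadic_bound:
  assumes q: "2 \<le> q" "q < 4" and K: "0 < K" and t: "0 < t" "t < 1"
    and S: "finite S" "S \<subseteq> int_lattice - {0}"
    and b: "\<And>m. m \<in> S \<Longrightarrow> \<bar>b m\<bar> \<le> K / sqrt (norm m) * min t (1 / norm m)"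
    and C: "\<And>F. finite F \<Longrightarrow>
      (\<Sum>j\<in>F. 2 powr ((3/2 - 2/q) * real j) * min t (2 powr (- real j))) \<le> C * t powr (1 - (3/2 - 2/q))"
  shows "(LINT x|lborel. indicator (square \<alpha>) x * \<bar>cos_poly S b x\<bar> powr q) \<le>
    (25 * K * C * t powr ((4 - q) / (2 * q))) powr q"
proof -
  define \<iota> where "\<iota> m = nat \<lfloor>log 2 (norm m)\<rfloor>" for m :: "real^2"
  define B where "B j = {m \<in> S. \<iota> m = j}" for j
  define J where "J = \<iota> ` S"
  have finJ: "finite J" using S by (simp add: J_def)
  have scale: "2 powr real j \<le> norm m" "norm m < 2 powr (real j + 1)" if "m \<in> B j" for m j
  proof -
    have m: "m \<in> int_lattice" "m \<noteq> 0" and j: "\<iota> m = j" using that S by (auto simp: B_def)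
    have n1: "norm m \<ge> 1" by (rule norm_int_lattice_ge_1[OF m])
    hence "log 2 (norm m) \<ge> 0" using m(2) by (subst zero_le_log_cancel_iff) auto
    hence "real j \<le> log 2 (norm m)" "log 2 (norm m) < real j + 1"
      using j unfolding \<iota>_def by linarith+
    moreover have "0 < norm m" using n1 by linarith
    ultimately show "2 powr real j \<le> norm m" "norm m < 2 powr (real j + 1)"
      using le_log_iff[of 2 "norm m" "real j"] log_less_iff[of 2 "norm m" "real j + 1"] by auto
  qed
  define \<beta> where "\<beta> j = K * 2 powr (- real j / 2) * min t (2 powr (- real j))" for j
  have \<beta>: "\<beta> j > 0" for j using K t by (simp add: \<beta>_def)
  have bB: "\<bar>b m\<bar> \<le> \<beta> j" if "m \<in> B j" for m j
  proof -
    have n0: "0 < norm m" using scale(1)[OF that] by (rule less_le_trans[rotated]) simp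
    have "\<bar>b m\<bar> \<le> K * (1 / sqrt (norm m)) * min t (1 / norm m)" using b[of m] that by (simp add: B_def)
    also have "\<dots> \<le> K * 2 powr (- real j / 2) * min t (2 powr (- real j))"
    proof -
      have "2 powr (real j / 2) = sqrt (2 powr real j)" by (simp add: powr_half_sqrt[symmetric] powr_powr)
      also have "\<dots> \<le> sqrt (norm m)" using scale(1)[OF that] by simp
      finally have "1 / sqrt (norm m) \<le> 1 / 2 powr (real j / 2)" by (intro frac_le) auto
      moreover have "1 / norm m \<le> 1 / 2 powr real j" using scale(1)[OF that] by (intro frac_le) auto
      hence "min t (1 / norm m) \<le> min t (2 powr (- real j))" by (simp add: powr_minus_divide min.coboundedI2)
      ultimately show ?thesis using K t n0
        by (intro mult_mono) (auto simp: powr_minus_divide)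
    qed
    finally show ?thesis by (simp add: \<beta>_def)
  qed
  define n where "n j = (25 * 4 ^ j :: real)" for j :: nat
  have n: "n j > 0" for j by (simp add: n_def)
  have cardB: "real (card (B j)) \<le> n j" for j
  proof -
    have "B j \<subseteq> {m \<in> int_lattice. norm m < 2 ^ (j + 1)}"
    proof
      fix m assume "m \<in> B j"
      moreover have "2 powr (real j + 1) = 2 ^ (j + 1)" by (simp add: powr_add powr_realpow)
      ultimately show "m \<in> {m \<in> int_lattice. norm m < 2 ^ (j + 1)}"
        using scale(2)[of m j] S by (auto simp: B_def)
    qed
    moreover have "finite {m \<in> int_lattice. norm m < 2 ^ (j + 1)}"
      by (rule finite_subset[OF _ finite_int_lattice_bounded[of "2 ^ (j + 1)"]]) auto
    ultimately have "card (B j) \<le> card {m \<in> int_lattice. norm m < 2 ^ (j + 1)}" by (intro card_mono)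
    thus ?thesis using card_int_lattice_dyadic[of j] by (simp add: n_def)
  qed
  define c where "c j = n j powr (1 - 1/q) * \<beta> j" for j
  have c: "c j > 0" for j using n \<beta> by (simp add: c_def less_imp_neq[OF n, symmetric])
  have split: "cos_poly S b x = (\<Sum>j\<in>J. cos_poly (B j) b x)" for x
    unfolding cos_poly_def B_def J_def using S by (subst sum.group) auto
  have "(LINT x|lborel. indicator (square \<alpha>) x * \<bar>cos_poly S b x\<bar> powr q) \<le> (\<Sum>j\<in>J. c j) powr q"
    unfolding split
  proof (rule Lq_triangle_inequality[OF finJ c])
    show "(LINT z|lborel. indicator (square \<alpha>) z * \<bar>cos_poly (B j) b z\<bar> powr q) \<le> c j powr q" for j
      unfolding c_def
      by (rule cos_poly_Lq_bound) (use S bB cardB n \<beta> q in \<open>auto simp: B_def\<close>)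
  qed (use q in \<open>auto intro: continuous_cos_poly\<close>)
  also have "\<dots> \<le> (25 * K * C * t powr ((4 - q) / (2 * q))) powr q"
  proof (rule powr_mono2)
    have cj: "c j \<le> 25 * K * (2 powr ((3/2 - 2/q) * real j) * min t (2 powr (- real j)))" for j
    proof -
      have "(4::real) ^ j = 2 powr (2 * real j)"
        by (simp add: powr_realpow[symmetric] powr_powr[symmetric] flip: powr_numeral)
      hence "n j powr (1 - 1/q) = 25 powr (1 - 1/q) * 2 powr (2 * real j * (1 - 1/q))"
        by (simp add: n_def powr_mult powr_powr)
      also have "\<dots> \<le> 25 powr 1 * 2 powr (2 * real j * (1 - 1/q))"
        using q by (intro mult_right_mono powr_mono) auto
      finally have "c j \<le> (25 * 2 powr (2 * real j * (1 - 1/q))) * \<beta> j"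
        unfolding c_def using \<beta>[of j] by (intro mult_right_mono) auto
      also have "\<dots> = 25 * K * ((2 powr (2 * real j * (1 - 1/q)) * 2 powr (- real j / 2)) * min t (2 powr (- real j)))"
        by (simp add: \<beta>_def mult_ac)
      also have "2 powr (2 * real j * (1 - 1/q)) * 2 powr (- real j / 2) = 2 powr ((3/2 - 2/q) * real j)"
        by (simp add: powr_add[symmetric] algebra_simps)
      finally show ?thesis .
    qed
    have "(\<Sum>j\<in>J. c j) \<le> 25 * K * (\<Sum>j\<in>J. 2 powr ((3/2 - 2/q) * real j) * min t (2 powr (- real j)))"
      unfolding sum_distrib_left by (intro sum_mono cj)
    also have "\<dots> \<le> 25 * K * (C * t powr (1 - (3/2 - 2/q)))"
      using K by (intro mult_left_mono C finJ) auto
    also have "1 - (3/2 - 2/q) = (4 - q) / (2 * q)" using q by (simp add: field_simps)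
    finally show "(\<Sum>j\<in>J. c j) \<le> 25 * K * C * t powr ((4 - q) / (2 * q))" by (simp only: mult.assoc)
  qed (use q less_imp_le[OF c] in \<open>auto intro!: sum_nonneg\<close>)
  finally show ?thesis .
qed

section \<open>Moments of the annulus discrepancy\<close>

text \<open>
  The constant has to be uniform in \<open>R\<close> and \<open>t\<close>; the bound for the smoothed counts does not depend on
  the degree \<open>N\<close> of smoothing, so it passes to the limit.
\<close>

lemma annulus_moment_bound:
  assumes q: "2 \<le> q" "q < 4"
  obtains C where "C > 0"
    "\<And>R t. 2 \<le> R \<Longrightarrow> 0 < t \<Longrightarrow> t < 1 \<Longrightarrow>
      (LINT x:unit_square|lebesgue. \<bar>annulus_discrepancy x R t\<bar> powr q) \<le>
        (C * sqrt R * t powr ((4 - q) / (2 * q))) powr q"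
proof -
  obtain C0 where C0: "C0 > 0"
    "\<And>R t m. 2 \<le> R \<Longrightarrow> 0 < t \<Longrightarrow> t < 1 \<Longrightarrow> m \<in> int_lattice \<Longrightarrow> m \<noteq> 0 \<Longrightarrow>
       \<bar>annulus_coeff R t m\<bar> \<le> C0 * sqrt R / sqrt (norm m) * min t (1 / norm m)"
    using annulus_coeff_bound by blast
  have "0 < 3/2 - 2/q" "3/2 - 2/q < 1" using q by (simp_all add: field_simps)
  then obtain C1 where C1: "C1 > 0"
    "\<And>F t. finite F \<Longrightarrow> 0 < t \<Longrightarrow> t < 1 \<Longrightarrow>
      (\<Sum>j\<in>F. 2 powr ((3/2 - 2/q) * real j) * min t (2 powr (- real j))) \<le> C1 * t powr (1 - (3/2 - 2/q))"
    using dyadic_sum_bound by blast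
  show ?thesis
  proof (rule that[of "50 * C0 * C1"])
    show "50 * C0 * C1 > 0" using C0 C1 by simp
    fix R t :: real assume R: "2 \<le> R" and t: "0 < t" "t < 1"
    show "(LINT x:unit_square|lebesgue. \<bar>annulus_discrepancy x R t\<bar> powr q) \<le>
        (50 * C0 * C1 * sqrt R * t powr ((4 - q) / (2 * q))) powr q"
    proof (rule annulus_moment_le)
      fix N
      obtain S b where S: "finite S" "S \<subseteq> int_lattice - {0}"
        and b: "\<And>m. m \<in> S \<Longrightarrow> \<bar>b m\<bar> \<le> 2 * \<bar>annulus_coeff R t m\<bar>"
        and eq: "\<And>x. smoothed_count R t N x - measure lebesgue (annulus R t) = cos_poly S b x"
        using smoothed_count_expansion[of R t N] by metis
      have "(LINT x|lborel. indicator unit_square x * \<bar>cos_poly S b x\<bar> powr q) \<le>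
        (25 * (2 * C0 * sqrt R) * C1 * t powr ((4 - q) / (2 * q))) powr q"
        unfolding unit_square_eq
      proof (rule cos_poly_Lq_dyadic_bound[OF q _ t S])
        show "0 < 2 * C0 * sqrt R" using C0 R by simp
        fix m assume m: "m \<in> S"
        have "\<bar>b m\<bar> \<le> 2 * \<bar>annulus_coeff R t m\<bar>" by (rule b[OF m])
        also have "\<dots> \<le> 2 * (C0 * sqrt R / sqrt (norm m) * min t (1 / norm m))"
          using C0(2)[OF R t, of m] m S by (intro mult_left_mono) auto
        finally show "\<bar>b m\<bar> \<le> 2 * C0 * sqrt R / sqrt (norm m) * min t (1 / norm m)" by simp
      qed (rule C1(2)[OF _ t])
      also have "25 * (2 * C0 * sqrt R) * C1 = 50 * C0 * C1 * sqrt R" by simp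
      finally show "(LINT x|lborel. indicator unit_square x *
          \<bar>smoothed_count R t N x - measure lebesgue (annulus R t)\<bar> powr q) \<le>
          (50 * C0 * C1 * sqrt R * t powr ((4 - q) / (2 * q))) powr q" by (simp only: eq)
    qed (use q in simp)
  qed
qed

section \<open>The uniform bound and interpolation\<close>

lemma measure_ball_scale:
  assumes "0 \<le> r"
  shows "measure lebesgue (ball (0 :: real^2) r) = r\<^sup>2 * measure lebesgue unit_disk"
    and "measure lebesgue (cball (0 :: real^2) r) = r\<^sup>2 * measure lebesgue unit_disk"
  using assms by (simp_all add: unit_disk_def content_ball content_cball)

lemma measure_annulus:
  assumes "0 < t" "t < R"
  shows "measure lebesgue (annulus R t) = (R + t)\<^sup>2 * measure lebesgue unit_disk - (R - t)\<^sup>2 * measure lebesgue unit_disk"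
proof -
  have "annulus R t = cball 0 (R + t) - ball 0 (R - t)" by (auto simp: annulus_def)
  moreover have "measure lebesgue (cball 0 (R + t) - ball 0 (R - t) :: (real^2) set) =
      measure lebesgue (cball (0 :: real^2) (R + t)) - measure lebesgue (ball (0 :: real^2) (R - t))"
    using assms by (intro measurable_measure_Diff) auto
  moreover have "0 \<le> R + t" "0 \<le> R - t" using assms by auto
  ultimately show ?thesis by (simp only: measure_ball_scale)
qed

lemma discrepancy_unit_disk_eq:
  assumes x: "x \<in> unit_square" and r: "0 < r" and B: "r + 2 \<le> B"
  shows "discrepancy unit_disk x r =
    (\<Sum>k\<in>{k \<in> int_lattice. norm k \<le> B}. indicator (ball 0 r) (k + x)) - r\<^sup>2 * measure lebesgue unit_disk"
proof -
  let ?K = "{k \<in> int_lattice. norm k \<le> B}"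
  have mem: "k \<in> dilate_shift r unit_disk x \<longleftrightarrow> norm (k + x) < r" for k
    using r by (simp add: dilate_shift_def unit_disk_def)
  have "norm k \<le> B" if "norm (k + x) < r" for k
    using norm_triangle_ineq4[of "k + x" x] norm_unit_square[OF x] that B by simp
  hence "(\<Sum>\<^sub>\<infinity>k\<in>int_lattice. indicator (dilate_shift r unit_disk x) k :: real) =
      (\<Sum>\<^sub>\<infinity>k\<in>?K. indicator (ball 0 r) (k + x))"
    by (intro infsum_cong_neutral) (auto simp: indicator_def mem)
  also have "\<dots> = (\<Sum>k\<in>?K. indicator (ball 0 r) (k + x))"
    by (intro infsum_finite finite_int_lattice_bounded)
  finally show ?thesis by (simp only: discrepancy_def)
qed

text \<open>
  The annulus is closed, whereas the disks are open: the annulus lies between the differences of open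
  disks with outer radii \<open>R + t\<close> and \<open>R + t + 1/R\<close>. The latter radius increases the area only by a
  bounded amount.
\<close>

lemma annulus_discrepancy_between:
  assumes x: "x \<in> unit_square" and R: "2 \<le> R" and t: "0 < t" "t < 1"
  shows "discrepancy unit_disk x (R + t) - discrepancy unit_disk x (R - t) \<le> annulus_discrepancy x R t"
    and "annulus_discrepancy x R t \<le> discrepancy unit_disk x (R + t + 1/R)
           - discrepancy unit_disk x (R - t) + 5 * measure lebesgue unit_disk"
proof -
  define v where "v = measure lebesgue unit_disk"
  have v: "v \<ge> 0" by (simp add: v_def)
  define K where "K = {k \<in> int_lattice. norm k \<le> R + 6}"
  let ?o = "\<lambda>r. \<Sum>k\<in>K. indicator (ball 0 r) (k + x) :: real"
  have disc: "discrepancy unit_disk x r = ?o r - r\<^sup>2 * v" if "0 < r" "r \<le> R + 3" for r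
    unfolding K_def v_def by (rule discrepancy_unit_disk_eq[OF x]) (use that in auto)
  have ann: "annulus_discrepancy x R t =
      (\<Sum>k\<in>K. indicator (annulus R t) (k + x)) - ((R + t)\<^sup>2 * v - (R - t)\<^sup>2 * v)"
    using annulus_discrepancy_eq_sum[OF x, of R t "R + 6"] measure_annulus[of t R] R t
    unfolding K_def v_def by simp
  \<comment> \<open>any margin of order \<open>1 / R\<close> keeps the change in area, about \<open>2 * R * \<eta>\<close> per unit of \<open>v\<close>, bounded\<close>
  define \<eta> where "\<eta> = 1 / R"
  have \<eta>: "0 < \<eta>" "\<eta> \<le> 1" "R * \<eta> = 1" using R by (simp_all add: \<eta>_def)
  have d1: "discrepancy unit_disk x (R + t) = ?o (R + t) - (R + t)\<^sup>2 * v"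
    by (rule disc) (use R t in auto)
  have d2: "discrepancy unit_disk x (R - t) = ?o (R - t) - (R - t)\<^sup>2 * v"
    by (rule disc) (use R t in auto)
  have d3: "discrepancy unit_disk x (R + t + \<eta>) = ?o (R + t + \<eta>) - (R + t + \<eta>)\<^sup>2 * v"
    by (rule disc) (use R t \<eta> in linarith)+
  have "?o (R + t) - ?o (R - t) \<le> (\<Sum>k\<in>K. indicator (annulus R t) (k + x))"
    unfolding sum_subtractf[symmetric] using t
    by (intro sum_mono) (auto simp: indicator_def annulus_def)
  thus "discrepancy unit_disk x (R + t) - discrepancy unit_disk x (R - t) \<le> annulus_discrepancy x R t"
    unfolding ann d1 d2 by linarith
  have "(\<Sum>k\<in>K. indicator (annulus R t) (k + x)) \<le> ?o (R + t + \<eta>) - ?o (R - t)"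
    unfolding sum_subtractf[symmetric] using t \<eta>
    by (intro sum_mono) (auto simp: indicator_def annulus_def)
  moreover have "(R + t + \<eta>)\<^sup>2 * v \<le> (R + t)\<^sup>2 * v + 5 * v"
  proof -
    have "(R + t + \<eta>)\<^sup>2 = (R + t)\<^sup>2 + (2 * (R * \<eta>) + 2 * (t * \<eta>) + \<eta>\<^sup>2)"
      by (simp add: power2_sum algebra_simps)
    moreover have "t * \<eta> \<le> 1 * 1" using t \<eta> by (intro mult_mono) auto
    moreover have "\<eta>\<^sup>2 \<le> 1" using \<eta> by (intro power_le_one) auto
    ultimately have "(R + t + \<eta>)\<^sup>2 \<le> (R + t)\<^sup>2 + 5" using \<eta>(3) by linarith
    from mult_right_mono[OF this v] show ?thesis by (simp add: distrib_right)
  qed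
  ultimately show "annulus_discrepancy x R t \<le> discrepancy unit_disk x (R + t + 1/R)
           - discrepancy unit_disk x (R - t) + 5 * measure lebesgue unit_disk"
    unfolding \<eta>_def[symmetric] ann d2 d3 v_def[symmetric] by linarith
qed

lemma annulus_discrepancy_sup_bound:
  fixes \<theta> :: real
  assumes \<theta>: "0 < \<theta>"
    and disk: "\<exists>C>0. \<forall>\<^sub>F R in at_top. \<forall>x\<in>unit_square. \<bar>discrepancy unit_disk x R\<bar> \<le> C * R powr \<theta>"
  obtains C R0 where "C > 0" "R0 \<ge> 2"
    "\<And>R t x. R0 \<le> R \<Longrightarrow> 0 < t \<Longrightarrow> t < 1 \<Longrightarrow> x \<in> unit_square \<Longrightarrow>
       \<bar>annulus_discrepancy x R t\<bar> \<le> C * R powr \<theta>"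
proof -
  obtain C R1 where C: "C > 0" and R1: "\<And>r x. R1 \<le> r \<Longrightarrow> x \<in> unit_square \<Longrightarrow>
      \<bar>discrepancy unit_disk x r\<bar> \<le> C * r powr \<theta>"
    using disk unfolding eventually_at_top_linorder by blast
  define v where "v = measure lebesgue unit_disk"
  have v: "v \<ge> 0" by (simp add: v_def)
  show ?thesis
  proof (rule that[of "2 * C * 2 powr \<theta> + 5 * v" "max 2 (R1 + 1)"])
    show "2 * C * 2 powr \<theta> + 5 * v > 0" using C v by (intro add_pos_nonneg) auto
    fix R t :: real and x :: "real^2"
    assume R: "max 2 (R1 + 1) \<le> R" and t: "0 < t" "t < 1" and x: "x \<in> unit_square"
    have R2: "2 \<le> R" using R by simp
    have b: "\<bar>discrepancy unit_disk x r\<bar> \<le> C * 2 powr \<theta> * R powr \<theta>" if "R - 1 \<le> r" "r \<le> 2 * R" for r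
    proof -
      have "\<bar>discrepancy unit_disk x r\<bar> \<le> C * r powr \<theta>" using R1[of r x] x R that by simp
      also have "\<dots> \<le> C * (2 * R) powr \<theta>"
        using C \<theta> that R2 by (intro mult_left_mono powr_mono2) auto
      also have "\<dots> = C * 2 powr \<theta> * R powr \<theta>" using R2 by (simp add: powr_mult)
      finally show ?thesis .
    qed
    have inv: "1 / R \<le> 1/2" "0 < 1 / R" using R2 by (simp_all add: field_simps)
    have "1 \<le> R powr \<theta>" using R2 \<theta> by (simp add: ge_one_powr_ge_zero)
    hence v5: "5 * v \<le> 5 * v * R powr \<theta>" using mult_left_mono[of 1 "R powr \<theta>" "5 * v"] v by simp
    have "\<bar>discrepancy unit_disk x (R + t)\<bar> \<le> C * 2 powr \<theta> * R powr \<theta>"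
      "\<bar>discrepancy unit_disk x (R - t)\<bar> \<le> C * 2 powr \<theta> * R powr \<theta>"
      "\<bar>discrepancy unit_disk x (R + t + 1/R)\<bar> \<le> C * 2 powr \<theta> * R powr \<theta>"
      by (rule b; use R2 t inv in linarith)+
    hence "\<bar>annulus_discrepancy x R t\<bar> \<le> 2 * (C * 2 powr \<theta> * R powr \<theta>) + 5 * v"
      using annulus_discrepancy_between[OF x R2 t] v unfolding v_def[symmetric] by linarith
    also have "\<dots> \<le> 2 * (C * 2 powr \<theta> * R powr \<theta>) + 5 * v * R powr \<theta>" using v5 by simp
    finally show "\<bar>annulus_discrepancy x R t\<bar> \<le> (2 * C * 2 powr \<theta> + 5 * v) * R powr \<theta>"
      by (simp add: distrib_right)
  qed simp
qed

lemma annulus_norm_interpolation: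
  assumes q: "0 < q" "q \<le> p" and s: "0 \<le> s"
    and sup: "\<And>x. x \<in> unit_square \<Longrightarrow> \<bar>annulus_discrepancy x R t\<bar> \<le> s"
    and M: "(LINT x:unit_square|lebesgue. \<bar>annulus_discrepancy x R t\<bar> powr q) \<le> M"
  shows "annulus_discrepancy_norm p R t \<le> (s powr (p - q) * M) powr (1 / p)"
proof -
  let ?D = "\<lambda>x. \<bar>annulus_discrepancy x R t\<bar>"
  have intq: "set_integrable lebesgue unit_square (\<lambda>x. s powr (p - q) * ?D x powr q)"
    using annulus_discrepancy_norm_integrable[OF q(1)] by (rule set_integrable_mult_right)
  have "(LINT x:unit_square|lebesgue. ?D x powr p) \<le> (LINT x:unit_square|lebesgue. s powr (p - q) * ?D x powr q)"
  proof (rule set_integral_mono[OF annulus_discrepancy_norm_integrable intq])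
    fix x assume x: "x \<in> unit_square"
    show "?D x powr p \<le> s powr (p - q) * ?D x powr q"
    proof (cases "annulus_discrepancy x R t = 0")
      case False
      have "?D x powr p = ?D x powr (p - q) * ?D x powr q" by (simp flip: powr_add)
      also have "\<dots> \<le> s powr (p - q) * ?D x powr q"
        using sup[OF x] q by (intro mult_right_mono powr_mono2) auto
      finally show ?thesis .
    qed simp
  qed (use q in simp)
  also have "\<dots> = s powr (p - q) * (LINT x:unit_square|lebesgue. ?D x powr q)" by simp
  also have "\<dots> \<le> s powr (p - q) * M" using M by (intro mult_left_mono) auto
  finally have le: "(LINT x:unit_square|lebesgue. ?D x powr p) \<le> s powr (p - q) * M" .
  have "0 \<le> (LINT x:unit_square|lebesgue. ?D x powr p)"
    unfolding set_lebesgue_integral_def by (intro integral_nonneg_AE AE_I2) simp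
  thus ?thesis unfolding annulus_discrepancy_norm_def using le q by (intro powr_mono2) auto
qed

lemma annulus_norm_bound_below_4:
  assumes p: "2 \<le> p" "p < 4"
  obtains C where "C > 0"
    "\<And>R t. 2 \<le> R \<Longrightarrow> 0 < t \<Longrightarrow> t < 1 \<Longrightarrow>
       annulus_discrepancy_norm p R t \<le> C * (R powr (1/2) * t powr ((4 - p) / (2 * p)))"
proof -
  obtain C where C: "C > 0"
    "\<And>R t. 2 \<le> R \<Longrightarrow> 0 < t \<Longrightarrow> t < 1 \<Longrightarrow>
      (LINT x:unit_square|lebesgue. \<bar>annulus_discrepancy x R t\<bar> powr p) \<le>
        (C * sqrt R * t powr ((4 - p) / (2 * p))) powr p"
    using annulus_moment_bound[OF p] by blast
  show ?thesis
  proof (rule that[OF C(1)])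
    fix R t :: real assume R: "2 \<le> R" and t: "0 < t" "t < 1"
    have "0 \<le> (LINT x:unit_square|lebesgue. \<bar>annulus_discrepancy x R t\<bar> powr p)"
      unfolding set_lebesgue_integral_def by (intro integral_nonneg_AE AE_I2) simp
    hence "annulus_discrepancy_norm p R t \<le> ((C * sqrt R * t powr ((4 - p) / (2 * p))) powr p) powr (1 / p)"
      unfolding annulus_discrepancy_norm_def using C(2)[OF R t] p by (intro powr_mono2) auto
    also have "\<dots> = C * sqrt R * t powr ((4 - p) / (2 * p))"
      using C(1) R p by (simp add: powr_powr)
    finally show "annulus_discrepancy_norm p R t \<le> C * (R powr (1/2) * t powr ((4 - p) / (2 * p)))"
      using R by (simp add: powr_half_sqrt mult.assoc)
  qed
qed

lemma annulus_norm_bound_from_L2: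
  fixes \<theta> p :: real
  assumes p: "2 \<le> p" and \<theta>: "0 < \<theta>"
    and disk: "\<exists>C>0. \<forall>\<^sub>F R in at_top. \<forall>x\<in>unit_square. \<bar>discrepancy unit_disk x R\<bar> \<le> C * R powr \<theta>"
  obtains C R0 where "C > 0"
    "\<And>R t. R0 \<le> R \<Longrightarrow> 0 < t \<Longrightarrow> t < 1 \<Longrightarrow>
       annulus_discrepancy_norm p R t \<le> C * ((R * t) powr (1 / p) * R powr (\<theta> * (p - 2) / p))"
proof -
  obtain s R0 where s: "s > 0" "R0 \<ge> 2"
    "\<And>R t x. R0 \<le> R \<Longrightarrow> 0 < t \<Longrightarrow> t < 1 \<Longrightarrow> x \<in> unit_square \<Longrightarrow>
       \<bar>annulus_discrepancy x R t\<bar> \<le> s * R powr \<theta>"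
    using annulus_discrepancy_sup_bound[OF \<theta> disk] by blast
  obtain C where C: "C > 0"
    "\<And>R t. 2 \<le> R \<Longrightarrow> 0 < t \<Longrightarrow> t < 1 \<Longrightarrow>
      (LINT x:unit_square|lebesgue. \<bar>annulus_discrepancy x R t\<bar> powr 2) \<le>
        (C * sqrt R * t powr ((4 - 2) / (2 * 2))) powr 2"
    using annulus_moment_bound[of 2] by auto
  show ?thesis
  proof (rule that[of "(s powr (p - 2) * C\<^sup>2) powr (1 / p)" R0])
    show "(s powr (p - 2) * C\<^sup>2) powr (1 / p) > 0" using s C by simp
    fix R t :: real assume R: "R0 \<le> R" and t: "0 < t" "t < 1"
    have R2: "2 \<le> R" using R s by simp
    have "annulus_discrepancy_norm p R t \<le>
        ((s * R powr \<theta>) powr (p - 2) * (C * sqrt R * t powr ((4 - 2) / (2 * 2))) powr 2) powr (1 / p)"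
      by (rule annulus_norm_interpolation) (use p s C R R2 t in auto)
    also have "(C * sqrt R * t powr ((4 - 2) / (2 * 2))) powr 2 = C\<^sup>2 * (R * t)"
      using C R2 t by (simp add: powr_half_sqrt power_mult_distrib)
    also have "(s * R powr \<theta>) powr (p - 2) * (C\<^sup>2 * (R * t)) =
        (s powr (p - 2) * C\<^sup>2) * ((R * t) * R powr (\<theta> * (p - 2)))"
      using s R2 by (simp add: powr_mult powr_powr mult_ac)
    also have "\<dots> powr (1 / p) =
        (s powr (p - 2) * C\<^sup>2) powr (1 / p) * ((R * t) powr (1 / p) * R powr (\<theta> * (p - 2) / p))"
    proof -
      have nn: "0 \<le> s powr (p - 2) * C\<^sup>2" "0 \<le> R * t" "0 \<le> R powr (\<theta> * (p - 2))" using R2 t by simp_all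
      have "(s powr (p - 2) * C\<^sup>2 * (R * t * R powr (\<theta> * (p - 2)))) powr (1 / p) =
          (s powr (p - 2) * C\<^sup>2) powr (1 / p) * ((R * t) powr (1 / p) * (R powr (\<theta> * (p - 2))) powr (1 / p))"
        using nn by (simp only: powr_mult mult_nonneg_nonneg)
      thus ?thesis by (simp add: powr_powr)
    qed
    finally show "annulus_discrepancy_norm p R t \<le> (s powr (p - 2) * C\<^sup>2) powr (1 / p) *
        ((R * t) powr (1 / p) * R powr (\<theta> * (p - 2) / p))" .
  qed
qed

text \<open>
  The moment bound is not available at \<open>q = 4\<close>, so \<open>q = 4 - \<delta>\<close> is used. Passing from 4 to \<open>q\<close> costs at
  most a factor \<open>R powr (\<theta> * \<delta>)\<close>, and \<open>\<delta>\<close> is chosen with \<open>\<theta> * \<delta> \<le> \<epsilon>\<close>.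
\<close>

lemma annulus_norm_bound_above_4:
  fixes \<theta> p \<epsilon> :: real
  assumes p: "4 \<le> p" and \<theta>: "0 < \<theta>" and \<epsilon>: "0 < \<epsilon>"
    and disk: "\<exists>C>0. \<forall>\<^sub>F R in at_top. \<forall>x\<in>unit_square. \<bar>discrepancy unit_disk x R\<bar> \<le> C * R powr \<theta>"
  obtains C R0 where "C > 0"
    "\<And>R t. R0 \<le> R \<Longrightarrow> 0 < t \<Longrightarrow> t < 1 \<Longrightarrow>
       annulus_discrepancy_norm p R t \<le> C * R powr ((\<theta> * (p - 4) + 2 + \<epsilon>) / p)"
proof -
  define \<delta> where "\<delta> = min 2 (\<epsilon> / \<theta>)"
  have \<delta>: "0 < \<delta>" "\<delta> \<le> 2" using \<epsilon> \<theta> by (simp_all add: \<delta>_def)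
  have "\<delta> \<le> \<epsilon> / \<theta>" by (simp add: \<delta>_def)
  hence \<theta>\<delta>: "\<theta> * \<delta> \<le> \<epsilon>" using \<theta> by (simp add: field_simps)
  define q where "q = 4 - \<delta>"
  have q: "2 \<le> q" "q < 4" using \<delta> by (simp_all add: q_def)
  obtain s R0 where s: "s > 0" "R0 \<ge> 2"
    "\<And>R t x. R0 \<le> R \<Longrightarrow> 0 < t \<Longrightarrow> t < 1 \<Longrightarrow> x \<in> unit_square \<Longrightarrow>
       \<bar>annulus_discrepancy x R t\<bar> \<le> s * R powr \<theta>"
    using annulus_discrepancy_sup_bound[OF \<theta> disk] by blast
  obtain C where C: "C > 0"
    "\<And>R t. 2 \<le> R \<Longrightarrow> 0 < t \<Longrightarrow> t < 1 \<Longrightarrow>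
      (LINT x:unit_square|lebesgue. \<bar>annulus_discrepancy x R t\<bar> powr q) \<le>
        (C * sqrt R * t powr ((4 - q) / (2 * q))) powr q"
    using annulus_moment_bound[OF q] by blast
  show ?thesis
  proof (rule that[of "(s powr (p - q) * C powr q) powr (1 / p)" R0])
    show "(s powr (p - q) * C powr q) powr (1 / p) > 0" using s C by simp
    fix R t :: real assume R: "R0 \<le> R" and t: "0 < t" "t < 1"
    have R2: "2 \<le> R" using R s by simp
    have "annulus_discrepancy_norm p R t \<le> ((s * R powr \<theta>) powr (p - q) * (C * sqrt R) powr q) powr (1 / p)"
    proof (rule annulus_norm_interpolation)
      have "t powr ((4 - q) / (2 * q)) \<le> 1 powr ((4 - q) / (2 * q))"
        using t q by (intro powr_mono2) auto
      hence "C * sqrt R * t powr ((4 - q) / (2 * q)) \<le> C * sqrt R * 1"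
        using C R2 by (intro mult_left_mono) auto
      hence "(C * sqrt R * t powr ((4 - q) / (2 * q))) powr q \<le> (C * sqrt R) powr q"
        using C R2 q by (intro powr_mono2) auto
      thus "(LINT x:unit_square|lebesgue. \<bar>annulus_discrepancy x R t\<bar> powr q) \<le> (C * sqrt R) powr q"
        using C(2)[OF R2 t] by (rule order_trans[rotated])
    qed (use p q s R t in auto)
    also have "(s * R powr \<theta>) powr (p - q) * (C * sqrt R) powr q =
        (s powr (p - q) * C powr q) * R powr (\<theta> * (p - q) + q / 2)"
      using s C R2 by (simp add: powr_mult powr_powr powr_add mult_ac flip: powr_half_sqrt)
    also have "\<dots> powr (1 / p) \<le> ((s powr (p - q) * C powr q) * R powr (\<theta> * (p - 4) + 2 + \<epsilon>)) powr (1 / p)"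
    proof (intro powr_mono2 mult_left_mono powr_mono)
      show "\<theta> * (p - q) + q / 2 \<le> \<theta> * (p - 4) + 2 + \<epsilon>"
      proof -
        have "\<theta> * (p - q) + q / 2 = \<theta> * (p - 4) + \<theta> * \<delta> + (2 - \<delta> / 2)"
          by (simp add: q_def algebra_simps diff_divide_distrib)
        thus ?thesis using \<theta>\<delta> \<delta> by linarith
      qed
    qed (use p R2 in auto)
    also have "\<dots> = (s powr (p - q) * C powr q) powr (1 / p) * R powr ((\<theta> * (p - 4) + 2 + \<epsilon>) / p)"
      by (subst powr_mult) (simp_all add: powr_powr)
    finally show "annulus_discrepancy_norm p R t \<le>
        (s powr (p - q) * C powr q) powr (1 / p) * R powr ((\<theta> * (p - 4) + 2 + \<epsilon>) / p)" .
  qed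
qed

theorem theorem2p2:
  fixes \<theta> p \<epsilon> :: real
  assumes "\<theta> > 0"
    and "\<exists>C>0. \<forall>\<^sub>F R in at_top. \<forall>x\<in>unit_square.
           \<bar>discrepancy unit_disk x R\<bar> \<le> C * R powr \<theta>"
    and "p \<ge> 2"
    and "\<epsilon> > 0"
  shows "\<exists>C>0. \<forall>\<^sub>F R in at_top. \<forall>t. 0 < t \<and> t < 1 \<longrightarrow>
           annulus_discrepancy_norm p R t \<le> C *
             (if R powr (1 - 2 * \<theta>) \<ge> t then (R * t) powr (1 / p) * R powr (\<theta> * (p - 2) / p)
              else if p < 4 then R powr (1 / 2) * t powr ((4 - p) / (2 * p))
              else R powr ((\<theta> * (p - 4) + 2 + \<epsilon>) / p))"
proof -
  obtain C1 R1 where C1: "C1 > 0" "\<And>R t. R1 \<le> R \<Longrightarrow> 0 < t \<Longrightarrow> t < 1 \<Longrightarrow>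
       annulus_discrepancy_norm p R t \<le> C1 * ((R * t) powr (1 / p) * R powr (\<theta> * (p - 2) / p))"
    using annulus_norm_bound_from_L2[OF assms(3,1,2)] by blast
  obtain C2 R2 where C2: "C2 > 0" "\<And>R t. R2 \<le> R \<Longrightarrow> 0 < t \<Longrightarrow> t < 1 \<Longrightarrow>
       annulus_discrepancy_norm p R t \<le> C2 * (if p < 4 then R powr (1 / 2) * t powr ((4 - p) / (2 * p))
              else R powr ((\<theta> * (p - 4) + 2 + \<epsilon>) / p))"
  proof (cases "p < 4")
    case True
    obtain C where "C > 0" "\<And>R t. 2 \<le> R \<Longrightarrow> 0 < t \<Longrightarrow> t < 1 \<Longrightarrow>
        annulus_discrepancy_norm p R t \<le> C * (R powr (1/2) * t powr ((4 - p) / (2 * p)))"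
      using annulus_norm_bound_below_4[OF assms(3) True] by blast
    thus ?thesis using True by (intro that[of C 2]) auto
  next
    case False
    hence "4 \<le> p" by simp
    then obtain C R0 where "C > 0" "\<And>R t. R0 \<le> R \<Longrightarrow> 0 < t \<Longrightarrow> t < 1 \<Longrightarrow>
        annulus_discrepancy_norm p R t \<le> C * R powr ((\<theta> * (p - 4) + 2 + \<epsilon>) / p)"
      using annulus_norm_bound_above_4[OF _ assms(1,4,2)] by blast
    thus ?thesis using False by (intro that[of C R0]) auto
  qed
  let ?g = "\<lambda>R t. if R powr (1 - 2 * \<theta>) \<ge> t then (R * t) powr (1 / p) * R powr (\<theta> * (p - 2) / p)
              else if p < 4 then R powr (1 / 2) * t powr ((4 - p) / (2 * p))
              else R powr ((\<theta> * (p - 4) + 2 + \<epsilon>) / p)"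
  have "annulus_discrepancy_norm p R t \<le> max C1 C2 * ?g R t"
    if R: "max R1 R2 \<le> R" and t: "0 < t" "t < 1" for R t
  proof -
    have "annulus_discrepancy_norm p R t \<le> (if R powr (1 - 2 * \<theta>) \<ge> t then C1 else C2) * ?g R t"
      using C1(2)[of R t] C2(2)[of R t] R t by simp
    also have "\<dots> \<le> max C1 C2 * ?g R t" by (rule mult_right_mono) auto
    finally show ?thesis .
  qed
  hence "\<forall>\<^sub>F R in at_top. \<forall>t. 0 < t \<and> t < 1 \<longrightarrow> annulus_discrepancy_norm p R t \<le> max C1 C2 * ?g R t"
    unfolding eventually_at_top_linorder by blast
  thus ?thesis using C1(1) by (intro exI[of _ "max C1 C2"] conjI) auto
qed

end
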